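(* Fix $H\in(\tfrac12,1)$, $\sigma>0$ and a continuous $a:[0,1]\to\mathbb{R}$. For any sequence of integers $N_n\geq n$, $$\lim_{n\to\infty}\frac{|\mathcal{A}_n^{(N_n,H)}|}{2^{n-1}}=P(|\mathcal{Y}_H|>g_H)>0.$$ In particular, $$\lim_{N\to\infty}\frac{|\mathcal{A}^{(N,H)}|}{2^N-1}=P(|\mathcal{Y}_H|>g_H).$$
   Context: Let $c_H=\sqrt{\frac{2H\,\Gamma(\frac32-H)}{\Gamma(H+\frac12)\Gamma(2-2H)}}$, $C_H=c_H(H-\frac12)$ and $k_H(t,s)=C_H\, s^{\frac12-H}\int_s^t u^{H-\frac12}(u-s)^{H-\frac32}\,du$. For integers $N>1$, $1\le i<n\le N$, set $J_n^{(N,H)}(i)=\sigma\sqrt N\int_{(i-1)/N}^{i/N}\big(k_H(\tfrac nN,u)-k_H(\tfrac{n-1}N,u)\big)du$, and for $1\le n\le N$ set $g_n^{(N,H)}=\sigma\sqrt N\int_{(n-1)/N}^{n/N}k_H(\tfrac nN,u)\,du$ and $a_n^{(N)}=\frac1N a(n/N)$. For $x\in\{-1,1\}^{n-1}$ let $Y_n^{(N,H)}(x)=\sum_{i=1}^{n-1}J_n^{(N,H)}(i)x_i$ (with $Y_1^{(N,H)}=0$), $u_n^{(N)}(x)=Y_n^{(N,H)}(x)+g_n^{(N,H)}$, $d_n^{(N)}(x)=Y_n^{(N,H)}(x)-g_n^{(N,H)}$. The $N$-binary tree is $\mathbb{X}_N=\{\tau\}\cup\bigcup_{n=1}^{N-1}\{-1,1\}^n$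 (so $|\mathbb{X}_N|=2^N-1$). For $n\ge2$, $\mathcal{A}_n^{(N,H)}=\{x\in\{-1,1\}^{n-1}: u_n^{(N)}(x)\le -a_n^{(N)}\text{ or } d_n^{(N)}(x)\ge -a_n^{(N)}\}$; $\mathcal{A}_1^{(N,H)}=\{\tau\}$ if $u_1^{(N)}\le -a_1^{(N)}$ or $d_1^{(N)}\ge -a_1^{(N)}$, and $\emptyset$ otherwise; $\mathcal{A}^{(N,H)}=\bigcup_{n=1}^N\mathcal{A}_n^{(N,H)}$. Let $(\xi_k)_{k\ge1}$ be i.i.d. with $P(\xi_k=1)=P(\xi_k=-1)=\frac12$, $h=\frac H2+\frac14$, $\rho_h(k)=\frac12\big((k+1)^{2h}+(k-1)^{2h}-2k^{2h}\big)$, $g_H=\frac{\sigma c_H}{H+\frac12}$, and $\mathcal{Y}_H=2g_H\sum_{k=1}^\infty\rho_h(k)\xi_k$ (the series converges almost surely). *)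

theory Defs
  imports "HOL-Probability.Probability"
begin

definition cH :: "real \<Rightarrow> real" where
  "cH H = sqrt (2 * H * Gamma (3/2 - H) / (Gamma (H + 1/2) * Gamma (2 - 2*H)))"

definition CH :: "real \<Rightarrow> real" where
  "CH H = cH H * (H - 1/2)"

definition kH :: "real \<Rightarrow> real \<Rightarrow> real \<Rightarrow> real" where
  "kH H t s = CH H * s powr (1/2 - H) *
     (LINT u:{s..t}|lborel. u powr (H - 1/2) * (u - s) powr (H - 3/2))"

definition Jn :: "real \<Rightarrow> real \<Rightarrow> nat \<Rightarrow> nat \<Rightarrow> nat \<Rightarrow> real" where
  "Jn H \<sigma> N n i = \<sigma> * sqrt (real N) *
     (LINT u:{(real i - 1) / real N .. real i / real N}|lborel.
        kH H (real n / real N) u - kH H ((real n - 1) / real N) u)"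

definition gn :: "real \<Rightarrow> real \<Rightarrow> nat \<Rightarrow> nat \<Rightarrow> real" where
  "gn H \<sigma> N n = \<sigma> * sqrt (real N) *
     (LINT u:{(real n - 1) / real N .. real n / real N}|lborel. kH H (real n / real N) u)"

definition an :: "(real \<Rightarrow> real) \<Rightarrow> nat \<Rightarrow> nat \<Rightarrow> real" where
  "an a N n = a (real n / real N) / real N"

text \<open>Elements x of {-1,1}^(n-1) are lists of length n-1; x_i is xs ! (i-1).
  The root tau of the tree is the empty list.\<close>
definition Yn :: "real \<Rightarrow> real \<Rightarrow> nat \<Rightarrow> nat \<Rightarrow> real list \<Rightarrow> real" where
  "Yn H \<sigma> N n xs = (\<Sum>i=1..n-1. Jn H \<sigma> N n i * xs ! (i - 1))"

definition un :: "real \<Rightarrow> real \<Rightarrow> nat \<Rightarrow> nat \<Rightarrow> real list \<Rightarrow> real" where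
  "un H \<sigma> N n xs = Yn H \<sigma> N n xs + gn H \<sigma> N n"

definition dn :: "real \<Rightarrow> real \<Rightarrow> nat \<Rightarrow> nat \<Rightarrow> real list \<Rightarrow> real" where
  "dn H \<sigma> N n xs = Yn H \<sigma> N n xs - gn H \<sigma> N n"

definition An :: "real \<Rightarrow> real \<Rightarrow> (real \<Rightarrow> real) \<Rightarrow> nat \<Rightarrow> nat \<Rightarrow> real list set" where
  "An H \<sigma> a N n = {xs. length xs = n - 1 \<and> set xs \<subseteq> {-1, 1} \<and>
      (un H \<sigma> N n xs \<le> - an a N n \<or> dn H \<sigma> N n xs \<ge> - an a N n)}"

definition Aset :: "real \<Rightarrow> real \<Rightarrow> (real \<Rightarrow> real) \<Rightarrow> nat \<Rightarrow> real list set" where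
  "Aset H \<sigma> a N = (\<Union>n\<in>{1..N}. An H \<sigma> a N n)"

definition hpar :: "real \<Rightarrow> real" where
  "hpar H = H / 2 + 1/4"

definition rho :: "real \<Rightarrow> nat \<Rightarrow> real" where
  "rho h k = ((real k + 1) powr (2*h) + (real k - 1) powr (2*h) - 2 * real k powr (2*h)) / 2"

definition gH :: "real \<Rightarrow> real \<Rightarrow> real" where
  "gH H \<sigma> = \<sigma> * cH H / (H + 1/2)"

text \<open>Probability space of an i.i.d. sequence of symmetric signs (xi_k), k \<ge> 1
  (coordinate 0 is unused).\<close>
definition Rad :: "(nat \<Rightarrow> real) measure" where
  "Rad = PiM UNIV (\<lambda>_. measure_pmf (pmf_of_set {-1::real, 1}))"

definition YH :: "real \<Rightarrow> real \<Rightarrow> (nat \<Rightarrow> real) \<Rightarrow> real" where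
  "YH H \<sigma> \<xi> = 2 * gH H \<sigma> * (\<Sum>k. rho (hpar H) (Suc k) * \<xi> (Suc k))"

end

theory Submission
  imports Defs "HOL-Real_Asymp.Real_Asymp"
begin

text \<open>Multiplying by \<open>N powr H\<close> removes \<open>N\<close> from the coefficients. The estimate
  \<open>u powr (H - 1/2) \<le> s powr (H - 1/2) + (u - s) powr (H - 1/2)\<close> inside the kernel shows that the
  rescaled \<open>Jn\<close> at \<open>i = n - k\<close> exceeds \<open>2 * gH * rho k\<close> by at most a constant times
  \<open>k powr (2H - 2) * i powr (1/2 - H)\<close>, whose sum of squares over \<open>i + k = n\<close> tends to \<open>0\<close>, while the
  drift term is of order \<open>N powr (H - 1)\<close>. Reading the signs backwards, the rescaled \<open>Yn\<close> thus
  converges to \<open>YH\<close> in probability, uniformly in \<open>N \<ge> n\<close>.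

  The probabilistic facts about the Rademacher series rest on the invariance of its law under sign
  flips. They give a maximal inequality (hence almost sure convergence), the absence of atoms (so
  that the events \<open>\<bar>YH\<bar> > gH\<close> and \<open>\<bar>YH\<bar> \<ge> gH\<close> have the same probability), and, since
  \<open>rho\<close> is not summable, the positivity of the limit.\<close>

section \<open>Estimates for the kernel\<close>

text \<open>The scale \<open>N powr H\<close> arises because integrating a power
  \<open>H - 1/2\<close> over a cell of length \<open>1/N\<close> gives
  \<open>N powr (- (H + 1/2))\<close>, and the prefactor \<open>sqrt N\<close> removes the extra
  1/2. The error bounds on the coefficients have no small sum: over \<open>i + k = n\<close> they
  add up to order \<open>n powr (H - 1/2)\<close>. So \<open>Yn\<close> cannot be controlled sign by
  sign. Their squares are what counts, because the signs are orthogonal. Even the squares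
  \<open>k powr (4H - 4)\<close> alone are not summable for \<open>H \<ge> 3/4\<close>, so the decay
  in \<open>i\<close> has to be kept through every kernel estimate and combined with the decay in
  \<open>k\<close> by a convolution bound. The limit coefficients decay like
  \<open>k powr (H - 3/2)\<close>: square summable, yet not summable. Hence convergence of the
  series needs a probabilistic argument, while its values are unbounded. In the second limit
  \<open>N\<close> is fixed while the level runs up to \<open>N\<close>. This calls for a limit
  uniform in \<open>N \<ge> n\<close>, which is equivalent to the statement for arbitrary
  sequences.\<close>

lemma powr_diff_le:
  fixes x y b :: real
  assumes "0 \<le> x" "x \<le> y" "b \<le> 1"
  shows "y powr b - x powr b \<le> (y - x) * y powr (b - 1)"
proof (cases "x = 0")
  case True
  then show ?thesis using assms by (cases "y = 0") (auto simp: powr_diff)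
next
  case False
  then have x: "x > 0" and y: "y > 0" using assms by auto
  have "x * y powr (b - 1) \<le> x * x powr (b - 1)"
    using assms x by (intro mult_left_mono powr_mono2') auto
  moreover have "x * x powr (b - 1) = x powr b" "y * y powr (b - 1) = y powr b"
    using x y by (simp_all add: powr_diff)
  ultimately show ?thesis by (simp add: algebra_simps)
qed

lemma powr_add_le_add:
  fixes x y b :: real
  assumes "0 \<le> x" "0 \<le> y" "0 < b" "b \<le> 1"
  shows "(x + y) powr b \<le> x powr b + y powr b"
proof (cases "y = 0")
  case False
  have "(x + y) powr b - x powr b \<le> y * (x + y) powr (b - 1)"
    using powr_diff_le[of x "x + y" b] assms by simp
  also have "\<dots> \<le> y * y powr (b - 1)"
    using assms False by (intro mult_left_mono powr_mono2') auto
  also have "\<dots> = y powr b" using assms False by (simp add: powr_diff)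
  finally show ?thesis by simp
qed (use assms in auto)

text \<open>The integrands \<open>(v - s) powr (b - 1)\<close> may be unbounded near an endpoint, so
  the derivative is asked for in the interior only and the fundamental theorem for the gauge
  integral is applied. Nonnegativity upgrades the result to Lebesgue integrability with the same
  value.\<close>

lemma set_integral_FTC_nonneg:
  fixes f f' :: "real \<Rightarrow> real"
  assumes "x \<le> y" "continuous_on {x..y} f"
    and "\<And>s. x < s \<Longrightarrow> s < y \<Longrightarrow> (f has_real_derivative f' s) (at s)"
    and [measurable]: "f' \<in> borel_measurable borel"
    and nn: "\<And>s. 0 \<le> f' s"
  shows "set_integrable lborel {x..y} f'" "(LINT s:{x..y}|lborel. f' s) = f y - f x"
proof -
  have hi: "(f' has_integral (f y - f x)) {x..y}"
    using assms by (intro fundamental_theorem_of_calculus_interior)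
      (auto simp: has_real_derivative_iff_has_vector_derivative)
  have eq: "(\<lambda>s. if s \<in> {x..y} then f' s else 0) = (\<lambda>s. indicator {x..y} s *\<^sub>R f' s)"
    by (auto simp: indicator_def)
  have "((\<lambda>s. indicator {x..y} s *\<^sub>R f' s) has_integral (f y - f x)) UNIV"
    using hi has_integral_restrict_UNIV[of "{x..y}" f'] unfolding eq by simp
  then have "integral\<^sup>N lborel (\<lambda>s. ennreal (indicator {x..y} s *\<^sub>R f' s)) = ennreal (f y - f x)"
    by (intro nn_integral_has_integral_lborel) (auto simp: nn)
  moreover have "0 \<le> f y - f x"
    by (rule has_integral_nonneg[OF hi]) (auto simp: nn)
  ultimately show "set_integrable lborel {x..y} f'" "(LINT s:{x..y}|lborel. f' s) = f y - f x"
    unfolding set_integrable_def set_lebesgue_integral_def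
    by (auto intro!: integrableI_nonneg integral_eq_nn_integral simp: nn integral_eq_nn_integral)
qed

lemma set_integral_powr_minus_left:
  fixes s x y b :: real
  assumes "s \<le> x" "x \<le> y" "0 < b"
  shows "set_integrable lborel {x..y} (\<lambda>v. (v - s) powr (b - 1))"
    "(LINT v:{x..y}|lborel. (v - s) powr (b - 1)) = ((y - s) powr b - (x - s) powr b) / b"
proof -
  have c: "continuous_on {x..y} (\<lambda>v. (v - s) powr b / b)"
    using assms by (intro continuous_intros continuous_on_powr') auto
  have d: "((\<lambda>v. (v - s) powr b / b) has_real_derivative (v - s) powr (b - 1)) (at v)"
    if "x < v" "v < y" for v
    using that assms by (auto intro!: derivative_eq_intros)
  note * = set_integral_FTC_nonneg[OF assms(2) c d]
  show "set_integrable lborel {x..y} (\<lambda>v. (v - s) powr (b - 1))" by (rule *) auto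
  have "(LINT v:{x..y}|lborel. (v - s) powr (b - 1)) = (y - s) powr b / b - (x - s) powr b / b"
    by (rule *) auto
  then show "(LINT v:{x..y}|lborel. (v - s) powr (b - 1)) = ((y - s) powr b - (x - s) powr b) / b"
    by (simp add: diff_divide_distrib)
qed

lemma set_integral_powr_minus_right:
  fixes t x y b :: real
  assumes "x \<le> y" "y \<le> t" "0 \<le> b"
  shows "set_integrable lborel {x..y} (\<lambda>s. (t - s) powr b)"
    "(LINT s:{x..y}|lborel. (t - s) powr b) = ((t - x) powr (b + 1) - (t - y) powr (b + 1)) / (b + 1)"
proof -
  have c: "continuous_on {x..y} (\<lambda>s. - ((t - s) powr (b + 1) / (b + 1)))"
    using assms by (intro continuous_intros continuous_on_powr') auto
  have d: "((\<lambda>s. - ((t - s) powr (b + 1) / (b + 1))) has_real_derivative (t - s) powr b) (at s)"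
    if "x < s" "s < y" for s
  proof -
    have "((\<lambda>s. (t - s) powr (b + 1)) has_real_derivative - ((b + 1) * (t - s) powr b)) (at s)"
      using that assms by (auto intro!: derivative_eq_intros)
    from DERIV_cdivide[OF DERIV_minus[OF this], of "b + 1"] show ?thesis
      using assms by simp
  qed
  note * = set_integral_FTC_nonneg[OF assms(1) c d]
  show "set_integrable lborel {x..y} (\<lambda>s. (t - s) powr b)" by (rule *) auto
  have "(LINT s:{x..y}|lborel. (t - s) powr b)
      = - ((t - y) powr (b + 1) / (b + 1)) - - ((t - x) powr (b + 1) / (b + 1))"
    by (rule *) auto
  then show "(LINT s:{x..y}|lborel. (t - s) powr b)
      = ((t - x) powr (b + 1) - (t - y) powr (b + 1)) / (b + 1)"
    by (simp add: diff_divide_distrib)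
qed

section \<open>The kernel of fractional Brownian motion and its time increments\<close>

lemma cH_pos:
  assumes "1/2 < H" "H < 1"
  shows "0 < cH H"
  unfolding cH_def using assms by (auto intro!: divide_pos_pos mult_pos_pos Gamma_real_pos)

lemma gH_pos:
  assumes "1/2 < H" "H < 1" "0 < \<sigma>"
  shows "0 < gH H \<sigma>"
  unfolding gH_def using assms cH_pos by (auto intro!: divide_pos_pos mult_pos_pos)

lemma set_integrable_kernel:
  fixes s t b :: real
  assumes "0 \<le> s" "s \<le> t" "0 < b"
  shows "set_integrable lborel {s..t} (\<lambda>u. u powr b * (u - s) powr (b - 1))"
proof (rule set_integrable_bound)
  show "set_integrable lborel {s..t} (\<lambda>u. t powr b * (u - s) powr (b - 1))"
    using assms by (intro set_integrable_mult_right set_integral_powr_minus_left) auto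
  show "set_borel_measurable lborel {s..t} (\<lambda>u. u powr b * (u - s) powr (b - 1))"
    unfolding set_borel_measurable_def by measurable
  show "AE u in lborel. u \<in> {s..t} \<longrightarrow>
      norm (u powr b * (u - s) powr (b - 1)) \<le> norm (t powr b * (u - s) powr (b - 1))"
    using assms by (auto intro!: AE_I2 mult_right_mono powr_mono2 simp: abs_mult)
qed

text \<open>The lower bound comes from \<open>s \<le> u\<close>, the upper bound from
  \<open>u powr b \<le> s powr b + (u - s) powr b\<close>, where \<open>b = H - 1/2\<close>.\<close>

lemma kH_diff_bounds:
  assumes H: "1/2 < H" "H < 1" and s: "0 < s" "s \<le> t1" "t1 \<le> t2"
  shows "cH H * ((t2 - s) powr (H - 1/2) - (t1 - s) powr (H - 1/2)) \<le> kH H t2 s - kH H t1 s" (is ?L)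
    and "kH H t2 s - kH H t1 s \<le> cH H * ((t2 - s) powr (H - 1/2) - (t1 - s) powr (H - 1/2))
      + cH H / 2 * s powr (1/2 - H) * ((t2 - s) powr (2*H - 1) - (t1 - s) powr (2*H - 1))" (is ?U)
proof -
  define b where "b = H - 1/2"
  have b: "0 < b" "b \<le> 1" "2*H - 1 = 2*b" "1/2 - H = -b" "H - 3/2 = b - 1" "CH H = cH H * b"
    using H by (auto simp: b_def CH_def)
  define f where "f = (\<lambda>u. u powr b * (u - s) powr (b - 1))"
  have intf: "set_integrable lborel {s..t} f" if "s \<le> t" for t
    unfolding f_def using set_integrable_kernel[of s t b] that s b by auto
  have K: "kH H t s = cH H * b * s powr (-b) * integral {s..t} f" if "s \<le> t" for t
    unfolding kH_def b b_def[symmetric] f_def[symmetric]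
    using set_borel_integral_eq_integral(2)[OF intf[OF that]] by simp
  \<comment> \<open>Both kernels integrate the same function from the same \<open>s\<close>, so the
    increment is a single integral over \<open>{t1..t2}\<close>.\<close>
  have "integral {s..t1} f + integral {t1..t2} f = integral {s..t2} f"
    using s set_borel_integral_eq_integral(1)[OF intf[of t2]] by (intro Henstock_Kurzweil_Integration.integral_combine) auto
  then have D: "kH H t2 s - kH H t1 s = cH H * b * s powr (-b) * integral {t1..t2} f"
    using s by (simp add: K algebra_simps flip: distrib_left)
  have sub: "set_integrable lborel {t1..t2} f"
    by (rule set_integrable_subset[OF intf[of t2]]) (use s in auto)
  have iD: "integral {t1..t2} f = (LINT u:{t1..t2}|lborel. f u)"
    using set_borel_integral_eq_integral(2)[OF sub] by simp
  note P1 = set_integral_powr_minus_left[OF s(2,3) b(1)]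
  have b2: "0 < 2*b" using b by simp
  note P2 = set_integral_powr_minus_left[OF s(2,3) b2]
  have "(LINT u:{t1..t2}|lborel. s powr b * (u - s) powr (b - 1)) \<le> (LINT u:{t1..t2}|lborel. f u)"
    unfolding f_def using s b P1 sub[unfolded f_def]
    by (intro set_integral_mono) (auto intro!: mult_right_mono powr_mono2)
  then have lo: "s powr b * (((t2 - s) powr b - (t1 - s) powr b) / b) \<le> (LINT u:{t1..t2}|lborel. f u)"
    by (simp add: P1)
  have "(LINT u:{t1..t2}|lborel. f u)
      \<le> (LINT u:{t1..t2}|lborel. s powr b * (u - s) powr (b - 1) + (u - s) powr (2*b - 1))"
  proof (rule set_integral_mono[OF sub])
    show "set_integrable lborel {t1..t2} (\<lambda>u. s powr b * (u - s) powr (b - 1) + (u - s) powr (2*b - 1))"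
      using P1 P2 by (intro set_integral_add set_integrable_mult_right) auto
    fix u assume u: "u \<in> {t1..t2}"
    have "u powr b \<le> s powr b + (u - s) powr b"
      using powr_add_le_add[of s "u - s" b] s u b by auto
    then have "f u \<le> (s powr b + (u - s) powr b) * (u - s) powr (b - 1)"
      unfolding f_def by (intro mult_right_mono) auto
    also have "\<dots> = s powr b * (u - s) powr (b - 1) + (u - s) powr (2*b - 1)"
      by (simp add: distrib_right flip: powr_add)
    finally show "f u \<le> s powr b * (u - s) powr (b - 1) + (u - s) powr (2*b - 1)" .
  qed
  also have "\<dots> = s powr b * (((t2 - s) powr b - (t1 - s) powr b) / b)
      + ((t2 - s) powr (2*b) - (t1 - s) powr (2*b)) / (2*b)"
    using P1 P2 by (subst set_integral_add) auto
  finally have up: "(LINT u:{t1..t2}|lborel. f u) \<le> s powr b * (((t2 - s) powr b - (t1 - s) powr b) / b)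
      + ((t2 - s) powr (2*b) - (t1 - s) powr (2*b)) / (2*b)" .
  have c: "0 \<le> cH H * b * s powr (-b)" using cH_pos[OF H] b by simp
  have ss: "s powr (-b) * s powr b = 1" using s by (simp flip: powr_add)
  have "cH H * ((t2 - s) powr b - (t1 - s) powr b)
      = cH H * b * s powr (-b) * (s powr b * (((t2 - s) powr b - (t1 - s) powr b) / b))"
    using b by (simp add: mult_ac ss[unfolded mult.commute[of "s powr (-b)"]] flip: mult.assoc[of "s powr b" "s powr (-b)"])
  also have "\<dots> \<le> cH H * b * s powr (-b) * (LINT u:{t1..t2}|lborel. f u)"
    by (rule mult_left_mono[OF lo c])
  finally show ?L unfolding D iD b b_def[symmetric] .
  have "cH H * b * s powr (-b) * (LINT u:{t1..t2}|lborel. f u) \<le>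
      cH H * b * s powr (-b) * (s powr b * (((t2 - s) powr b - (t1 - s) powr b) / b)
      + ((t2 - s) powr (2*b) - (t1 - s) powr (2*b)) / (2*b))"
    by (rule mult_left_mono[OF up c])
  also have "\<dots> = cH H * ((t2 - s) powr b - (t1 - s) powr b) * (s powr (-b) * s powr b)
      + cH H / 2 * s powr (-b) * ((t2 - s) powr (2*b) - (t1 - s) powr (2*b))"
    using b by (simp add: field_simps)
  finally show ?U unfolding D iD b b_def[symmetric] ss by simp
qed

lemma kH_self: "kH H s s = 0"
proof -
  have "(LINT u:{s..s}|lborel. u powr (H - 1/2) * (u - s) powr (H - 3/2)) = 0"
    unfolding set_lebesgue_integral_def
    by (intro integral_eq_zero_AE AE_I2) (auto simp: indicator_def)
  then show ?thesis by (simp add: kH_def)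
qed

lemma borel_measurable_kH [measurable]: "(\<lambda>s. kH H t s) \<in> borel_measurable borel"
proof -
  have eq: "indicator {s..t} u *\<^sub>R (u powr (H - 1/2) * (u - s) powr (H - 3/2))
      = (if s \<le> u \<and> u \<le> t then u powr (H - 1/2) * (u - s) powr (H - 3/2) else 0)" for s u
    by (auto simp: indicator_def)
  have "(\<lambda>s. LINT u|lborel. (if s \<le> u \<and> u \<le> t then u powr (H - 1/2) * (u - s) powr (H - 3/2) else 0))
      \<in> borel_measurable borel"
    by (rule lborel.borel_measurable_lebesgue_integral) measurable
  then show ?thesis
    unfolding kH_def set_lebesgue_integral_def eq by measurable
qed

text \<open>The point \<open>s = 0\<close> has to be excluded from the pointwise bounds: there
  \<open>s powr (1/2 - H)\<close> is 0 by convention, so the kernel vanishes and its lower bound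
  fails. The first cell contains this point, hence the comparison is made almost everywhere.\<close>

lemma set_integral_singular_bounds:
  fixes f F :: "real \<Rightarrow> real"
  assumes xy: "0 \<le> x" "x \<le> y" and b: "0 < b" "b < 1"
    and [measurable]: "f \<in> borel_measurable borel"
    and F: "set_integrable lborel {x..y} F"
    and bnd: "\<And>s. x \<le> s \<Longrightarrow> s \<le> y \<Longrightarrow> 0 < s \<Longrightarrow> F s \<le> f s \<and> f s \<le> F s + M * s powr (- b)"
  shows "(LINT s:{x..y}|lborel. F s) \<le> (LINT s:{x..y}|lborel. f s)"
    and "(LINT s:{x..y}|lborel. f s)
      \<le> (LINT s:{x..y}|lborel. F s) + M * ((y powr (1 - b) - x powr (1 - b)) / (1 - b))"
proof -
  note P = set_integral_powr_minus_left[of 0 x y "1 - b"]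
  have AE0: "AE s in lborel. s \<noteq> (0::real)" by (rule AE_lborel_singleton)
  have iG: "set_integrable lborel {x..y} (\<lambda>s. F s + M * s powr (- b))"
    using F P xy b by (intro set_integral_add set_integrable_mult_right) auto
  \<comment> \<open>\<open>f\<close> is only known to lie between two integrable functions; the sum
    of their absolute values dominates it.\<close>
  have iH: "set_integrable lborel {x..y} (\<lambda>s. \<bar>F s\<bar> + \<bar>F s + M * s powr (- b)\<bar>)"
    using set_integrable_abs[OF F] set_integrable_abs[OF iG] by (intro set_integral_add)
  have if': "set_integrable lborel {x..y} f"
  proof (rule set_integrable_bound[OF iH])
    show "set_borel_measurable lborel {x..y} f" unfolding set_borel_measurable_def by measurable
    show "AE s in lborel. s \<in> {x..y} \<longrightarrow> norm (f s) \<le> norm (\<bar>F s\<bar> + \<bar>F s + M * s powr (- b)\<bar>)"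
      using AE0
    proof eventually_elim
      case (elim s)
      show ?case using bnd[of s] elim xy by auto
    qed
  qed
  have "AE s \<in> {x..y} in lborel. F s \<le> f s \<and> f s \<le> F s + M * s powr (- b)"
    using AE0
  proof eventually_elim
    case (elim s)
    show ?case using bnd[of s] elim xy by auto
  qed
  then have A1: "AE s \<in> {x..y} in lborel. F s \<le> f s" 
    and A2: "AE s \<in> {x..y} in lborel. f s \<le> F s + M * s powr (- b)" by auto
  show "(LINT s:{x..y}|lborel. F s) \<le> (LINT s:{x..y}|lborel. f s)"
    by (rule set_integral_mono_AE[OF F if' A1])
  have "(LINT s:{x..y}|lborel. f s) \<le> (LINT s:{x..y}|lborel. F s + M * s powr (- b))"
    by (rule set_integral_mono_AE[OF if' iG A2])
  also have "\<dots> = (LINT s:{x..y}|lborel. F s) + M * ((y powr (1 - b) - x powr (1 - b)) / (1 - b))"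
    using P F xy b by (subst set_integral_add) auto
  finally show "(LINT s:{x..y}|lborel. f s)
      \<le> (LINT s:{x..y}|lborel. F s) + M * ((y powr (1 - b) - x powr (1 - b)) / (1 - b))" .
qed

text \<open>The left side is the integral of \<open>s powr (- b)\<close> over the
  \<open>i\<close>-th cell. Evaluating the power at the right endpoint keeps the bound finite for
  \<open>i = 1\<close>, where the cell starts at the singularity.\<close>

lemma singular_mass_le:
  fixes b :: real
  assumes "0 < b" "b < 1" "0 < i" "0 < N"
  shows "((real i / real N) powr (1 - b) - ((real i - 1) / real N) powr (1 - b)) / (1 - b)
    \<le> real N powr (b - 1) * real i powr (- b) / (1 - b)"
proof -
  have "(real i / real N) powr (1 - b) - ((real i - 1) / real N) powr (1 - b)
      \<le> (real i / real N - (real i - 1) / real N) * (real i / real N) powr (1 - b - 1)"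
    using assms by (intro powr_diff_le) (auto intro!: divide_right_mono)
  also have "\<dots> = real N powr (b - 1) * real i powr (- b)"
    using assms by (simp add: powr_divide powr_diff powr_minus divide_simps)
  finally show ?thesis using assms by (intro divide_right_mono) auto
qed

text \<open>The leading part of the kernel increment is a difference of powers of distances to
  \<open>s\<close>. Its cell integral is a second difference of the power \<open>H + 1/2\<close>,
  and this equals \<open>2 * hpar H\<close>, whence \<open>rho\<close>. The remainder keeps the
  singular factor \<open>s powr (1/2 - H)\<close>, whose cell integral yields the decay in
  \<open>i\<close>.\<close>

lemma Jn_bounds:
  assumes H: "1/2 < H" "H < 1" and s: "0 < \<sigma>" and i: "1 \<le> i" "i < n" "n \<le> N"
  shows "2 * gH H \<sigma> * rho (hpar H) (n - i) \<le> real N powr H * Jn H \<sigma> N n i" (is ?L)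
    and "real N powr H * Jn H \<sigma> N n i \<le> 2 * gH H \<sigma> * rho (hpar H) (n - i)
      + \<sigma> * cH H / (3 - 2*H) * (real (n - i) powr (2*H - 2) * real i powr (1/2 - H))" (is ?U)
proof -
  define b where "b = H - 1/2"
  define k where "k = n - i"
  have b: "0 < b" "b < 1/2" "H - 1/2 = b" "2*H - 1 = 2*b" "1/2 - H = -b" "2 * hpar H = b + 1"
      "H + 1/2 = b + 1" "2*H - 2 = 2*b - 1" "3 - 2*H = 2 * (1 - b)"
    using H by (auto simp: b_def hpar_def)
  have k: "1 \<le> k" "n = i + k" using i by (auto simp: k_def)
  have N: "0 < real N" using i by simp
  define x y t1 t2 where xy: "x = (real i - 1) / real N" "y = real i / real N"
      "t1 = (real n - 1) / real N" "t2 = real n / real N"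
  have ord: "0 \<le> x" "x \<le> y" "y \<le> t1" "t1 \<le> t2" "y \<le> t2"
    unfolding xy using i N by (auto intro!: divide_right_mono)
  define F where "F = (\<lambda>s. cH H * ((t2 - s) powr b - (t1 - s) powr b))"
  \<comment> \<open>In the remainder, \<open>t2 - t1 = 1/N\<close> and \<open>t2 - s\<close> is at
    least \<open>k/N\<close>, so the difference of powers \<open>2*b\<close> is at most
    \<open>1/N * (k/N) powr (2*b - 1)\<close>.\<close>
  define M where "M = cH H / 2 * (real N powr (- 2*b) * real k powr (2*b - 1))"
  note P2 = set_integral_powr_minus_right[OF ord(2,5) less_imp_le[OF b(1)]]
  note P1 = set_integral_powr_minus_right[OF ord(2,3) less_imp_le[OF b(1)]]
  have iF: "set_integrable lborel {x..y} F"
    unfolding F_def using P1 P2 by (intro set_integrable_mult_right set_integral_diff)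
  \<comment> \<open>Since \<open>t2 - y = t1 - x\<close>, the two first differences of the primitive
    share a point and combine into a second difference.\<close>
  have diffs: "t2 - x = (real k + 1) / real N" "t2 - y = real k / real N" "t1 - x = real k / real N"
      "t1 - y = (real k - 1) / real N" "t2 - t1 = 1 / real N"
    unfolding xy k(2) by (auto simp: add_divide_distrib diff_divide_distrib)
  have "(LINT s:{x..y}|lborel. F s) = cH H * (((t2 - x) powr (b+1) - (t2 - y) powr (b+1)) / (b+1)
      - ((t1 - x) powr (b+1) - (t1 - y) powr (b+1)) / (b+1))"
    unfolding F_def using P1 P2 by simp
  also have "\<dots> = real N powr (- (b+1)) * (2 * cH H / (b+1) * rho (hpar H) k)"
  proof -
    have *: "cH H * ((A / w - B / w) / e - (B / w - D / w) / e) = inverse w * (2 * cH H / e * ((A + D - 2 * B) / 2))"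
      for A B D w e :: real
      by (cases "e = 0"; cases "w = 0") (simp_all add: field_simps)
    have pd: "((real k + 1) / real N) powr (b+1) = (real k + 1) powr (b+1) / real N powr (b+1)"
      "(real k / real N) powr (b+1) = real k powr (b+1) / real N powr (b+1)"
      "((real k - 1) / real N) powr (b+1) = (real k - 1) powr (b+1) / real N powr (b+1)"
      using k N by (auto intro!: powr_divide)
    show ?thesis
      unfolding diffs rho_def b powr_minus[of "real N" "b+1"] pd by (rule *)
  qed
  finally have IF: "(LINT s:{x..y}|lborel. F s) = real N powr (- (b+1)) * (2 * cH H / (b+1) * rho (hpar H) k)" .
  have bnd: "F s \<le> kH H t2 s - kH H t1 s \<and> kH H t2 s - kH H t1 s \<le> F s + M * s powr (- b)"
    if "x \<le> s" "s \<le> y" "0 < s" for s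
  proof -
    have kd: "F s \<le> kH H t2 s - kH H t1 s"
      "kH H t2 s - kH H t1 s \<le> F s + cH H / 2 * s powr (-b) * ((t2 - s) powr (2*b) - (t1 - s) powr (2*b))"
      using kH_diff_bounds[OF H, of s t1 t2] that ord unfolding F_def b by auto
    have "(t2 - s) powr (2*b) - (t1 - s) powr (2*b) \<le> ((t2 - s) - (t1 - s)) * (t2 - s) powr (2*b - 1)"
      using that ord b by (intro powr_diff_le) auto
    also have "\<dots> \<le> 1 / real N * (t2 - y) powr (2*b - 1)"
      using that ord b N k diffs by (intro mult_mono powr_mono2') auto
    also have "\<dots> = real N powr (- 2*b) * real k powr (2*b - 1)"
      unfolding diffs using N k by (simp add: powr_divide powr_minus powr_diff divide_simps)
    finally have "cH H / 2 * s powr (-b) * ((t2 - s) powr (2*b) - (t1 - s) powr (2*b))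
        \<le> cH H / 2 * s powr (-b) * (real N powr (- 2*b) * real k powr (2*b - 1))"
      using cH_pos[OF H] by (intro mult_left_mono) auto
    then show ?thesis using kd unfolding M_def by (auto simp: mult_ac)
  qed
  have SB: "(LINT s:{x..y}|lborel. F s) \<le> (LINT s:{x..y}|lborel. kH H t2 s - kH H t1 s)"
    "(LINT s:{x..y}|lborel. kH H t2 s - kH H t1 s)
      \<le> (LINT s:{x..y}|lborel. F s) + M * ((y powr (1 - b) - x powr (1 - b)) / (1 - b))"
    by (rule set_integral_singular_bounds[of x y b, OF _ _ _ _ _ iF bnd]; use ord b in auto)+
  have NN: "real N powr (- (b+1)) = real N powr (- 2*b) * real N powr (b - 1)"
    by (simp flip: powr_add)
  have M0: "0 \<le> M" unfolding M_def using cH_pos[OF H] by auto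
  have "M * ((y powr (1 - b) - x powr (1 - b)) / (1 - b)) \<le> M * (real N powr (b - 1) * real i powr (- b) / (1 - b))"
    unfolding xy using i b N by (intro mult_left_mono[OF _ M0] singular_mass_le) auto
  also have "\<dots> = real N powr (- (b+1)) * (cH H / (2 * (1 - b)) * (real k powr (2*b - 1) * real i powr (- b)))"
    unfolding M_def NN by (simp add: mult_ac)
  finally have SU: "(LINT s:{x..y}|lborel. kH H t2 s - kH H t1 s) \<le> real N powr (- (b+1)) *
      (2 * cH H / (b+1) * rho (hpar H) k + cH H / (2 * (1 - b)) * (real k powr (2*b - 1) * real i powr (- b)))"
    using SB(2) unfolding IF by (simp add: distrib_left)
  have "real N powr H * sqrt (real N) = real N powr (b + 1)"
    unfolding b(7)[symmetric] powr_add using N by (simp add: powr_half_sqrt)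
  then have J: "real N powr H * Jn H \<sigma> N n i = \<sigma> * real N powr (b + 1) * (LINT s:{x..y}|lborel. kH H t2 s - kH H t1 s)"
    unfolding Jn_def xy by (simp add: mult_ac)
  have W: "real N powr (b+1) * real N powr (- (b+1)) = 1" using N by (simp flip: powr_add)
  have c: "0 \<le> \<sigma> * real N powr (b + 1)" using s by simp
  have "2 * gH H \<sigma> * rho (hpar H) k = \<sigma> * (real N powr (b+1) * real N powr (- (b+1))) * (2 * cH H / (b+1) * rho (hpar H) k)"
    unfolding W gH_def b by simp
  also have "\<dots> \<le> real N powr H * Jn H \<sigma> N n i"
    using mult_left_mono[OF SB(1) c] unfolding J IF by (simp add: mult_ac)
  finally show ?L unfolding k_def .
  have "real N powr H * Jn H \<sigma> N n i \<le> \<sigma> * (real N powr (b+1) * real N powr (- (b+1))) *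
      (2 * cH H / (b+1) * rho (hpar H) k + cH H / (2 * (1 - b)) * (real k powr (2*b - 1) * real i powr (- b)))"
    using mult_left_mono[OF SU c] unfolding J by (simp add: mult_ac)
  also have "\<dots> = 2 * gH H \<sigma> * rho (hpar H) k
      + \<sigma> * cH H / (2 * (1 - b)) * (real k powr (2*b - 1) * real i powr (- b))"
    unfolding W gH_def b by (simp add: distrib_left mult_ac)
  finally show ?U unfolding k_def b .
qed

text \<open>The kernel vanishes on the diagonal, so this is the increment estimate with
  \<open>t1 = s\<close>. The primitive contributes just one power of \<open>1/N\<close>, and the
  error decays through \<open>n\<close> alone because the distance to the last cell is zero.\<close>

lemma gn_bounds:
  assumes H: "1/2 < H" "H < 1" and s: "0 < \<sigma>" and n: "1 \<le> n" "n \<le> N"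
  shows "gH H \<sigma> \<le> real N powr H * gn H \<sigma> N n" (is ?L)
    and "real N powr H * gn H \<sigma> N n \<le> gH H \<sigma> + \<sigma> * cH H / (3 - 2*H) * real n powr (1/2 - H)" (is ?U)
proof -
  define b where "b = H - 1/2"
  have b: "0 < b" "b < 1/2" "H - 1/2 = b" "2*H - 1 = 2*b" "1/2 - H = -b"
      "H + 1/2 = b + 1" "3 - 2*H = 2 * (1 - b)"
    using H by (auto simp: b_def hpar_def)
  have N: "0 < real N" using n by simp
  define x y where xy: "x = (real n - 1) / real N" "y = real n / real N"
  have ord: "0 \<le> x" "x \<le> y" "y \<le> y"
    unfolding xy using n N by (auto intro!: divide_right_mono)
  define F where "F = (\<lambda>s. cH H * (y - s) powr b)"
  define M where "M = cH H / 2 * real N powr (- 2*b)"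
  note P = set_integral_powr_minus_right[OF ord(2,3) less_imp_le[OF b(1)]]
  have iF: "set_integrable lborel {x..y} F"
    unfolding F_def using P by (intro set_integrable_mult_right)
  have diffs: "y - x = 1 / real N"
    unfolding xy by (auto simp: diff_divide_distrib)
  have IF: "(LINT s:{x..y}|lborel. F s) = real N powr (- (b+1)) * (cH H / (b+1))"
    unfolding F_def powr_minus[of "real N" "b+1"] using N by (simp add: P diffs powr_divide divide_simps)
  have bnd: "F s \<le> kH H y s \<and> kH H y s \<le> F s + M * s powr (- b)"
    if "x \<le> s" "s \<le> y" "0 < s" for s
  proof -
    have kd: "F s \<le> kH H y s"
      "kH H y s \<le> F s + cH H / 2 * s powr (-b) * (y - s) powr (2*b)"
      using kH_diff_bounds[OF H, of s s y] that ord unfolding F_def b kH_self by auto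
    have "(y - s) powr (2*b) \<le> (1 / real N) powr (2*b)"
      using that ord b diffs by (intro powr_mono2) auto
    also have "\<dots> = real N powr (- 2*b)"
      using N by (simp add: powr_divide powr_minus divide_simps)
    finally have "cH H / 2 * s powr (-b) * (y - s) powr (2*b) \<le> cH H / 2 * s powr (-b) * real N powr (- 2*b)"
      using cH_pos[OF H] by (intro mult_left_mono) auto
    then show ?thesis using kd unfolding M_def by (auto simp: mult_ac)
  qed
  have SB: "(LINT s:{x..y}|lborel. F s) \<le> (LINT s:{x..y}|lborel. kH H y s)"
    "(LINT s:{x..y}|lborel. kH H y s)
      \<le> (LINT s:{x..y}|lborel. F s) + M * ((y powr (1 - b) - x powr (1 - b)) / (1 - b))"
    by (rule set_integral_singular_bounds[of x y b, OF _ _ _ _ _ iF bnd]; use ord b in auto)+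
  have NN: "real N powr (- (b+1)) = real N powr (- 2*b) * real N powr (b - 1)"
    by (simp flip: powr_add)
  have M0: "0 \<le> M" unfolding M_def using cH_pos[OF H] by auto
  have "M * ((y powr (1 - b) - x powr (1 - b)) / (1 - b)) \<le> M * (real N powr (b - 1) * real n powr (- b) / (1 - b))"
    unfolding xy using n b N by (intro mult_left_mono[OF _ M0] singular_mass_le) auto
  also have "\<dots> = real N powr (- (b+1)) * (cH H / (2 * (1 - b)) * real n powr (- b))"
    unfolding M_def NN by (simp add: mult_ac)
  finally have SU: "(LINT s:{x..y}|lborel. kH H y s) \<le> real N powr (- (b+1)) *
      (cH H / (b+1) + cH H / (2 * (1 - b)) * real n powr (- b))"
    using SB(2) unfolding IF by (simp add: distrib_left)
  have "real N powr H * sqrt (real N) = real N powr (b + 1)"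
    unfolding b(6)[symmetric] powr_add using N by (simp add: powr_half_sqrt)
  then have J: "real N powr H * gn H \<sigma> N n = \<sigma> * real N powr (b + 1) * (LINT s:{x..y}|lborel. kH H y s)"
    unfolding gn_def xy by (simp add: mult_ac)
  have W: "real N powr (b+1) * real N powr (- (b+1)) = 1" using N by (simp flip: powr_add)
  have c: "0 \<le> \<sigma> * real N powr (b + 1)" using s by simp
  have "gH H \<sigma> = \<sigma> * (real N powr (b+1) * real N powr (- (b+1))) * (cH H / (b+1))"
    unfolding W gH_def b by simp
  also have "\<dots> \<le> real N powr H * gn H \<sigma> N n"
    using mult_left_mono[OF SB(1) c] unfolding J IF by (simp add: mult_ac)
  finally show ?L .
  have "real N powr H * gn H \<sigma> N n \<le> \<sigma> * (real N powr (b+1) * real N powr (- (b+1))) *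
      (cH H / (b+1) + cH H / (2 * (1 - b)) * real n powr (- b))"
    using mult_left_mono[OF SU c] unfolding J by (simp add: mult_ac)
  also have "\<dots> = gH H \<sigma> + \<sigma> * cH H / (2 * (1 - b)) * real n powr (- b)"
    unfolding W gH_def b by (simp add: distrib_left mult_ac)
  finally show ?U unfolding b .
qed

section \<open>Size and partial sums of \<open>rho\<close>\<close>

lemma rho_bounds:
  assumes h: "1/2 < h" "h \<le> 1" and k: "1 \<le> k"
  shows "0 < rho h k" "rho h k \<le> h * real k powr (2*h - 2)"
proof -
  define p where "p = 2*h"
  have p: "1 < p" "p \<le> 2" "2*h - 2 = p - 2" "h = p / 2" using h by (auto simp: p_def)
  \<comment> \<open>\<open>rho\<close> is half the increment of the first difference
    \<open>?f\<close> from \<open>k - 1\<close> to \<open>k\<close>. The mean value theorem turns it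
    into a first difference of \<open>p * z powr (p - 1)\<close>, with \<open>k < z + 1\<close>. Its
    sign follows from \<open>p > 1\<close> and its size from \<open>p \<le> 2\<close>.\<close>
  let ?f = "\<lambda>x::real. (x + 1) powr p - x powr p"
  have "\<exists>l z. real k - 1 < z \<and> z < real k \<and> (?f has_real_derivative l) (at z) \<and>
      ?f (real k) - ?f (real k - 1) = (real k - (real k - 1)) * l"
  proof (rule MVT)
    show "continuous_on {real k - 1..real k} ?f"
      using k p by (intro continuous_intros continuous_on_powr') auto
    show "?f differentiable (at x)" if "real k - 1 < x" "x < real k" for x
      using that k unfolding real_differentiable_def by (auto intro!: exI derivative_eq_intros)
  qed simp
  then obtain l z where z: "real k - 1 < z" "z < real k" "(?f has_real_derivative l) (at z)"
    "?f (real k) - ?f (real k - 1) = l" by auto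
  have z0: "0 < z" using z k by simp
  have "(?f has_real_derivative p * (z + 1) powr (p - 1) - p * z powr (p - 1)) (at z)"
    using z0 by (auto intro!: derivative_eq_intros)
  then have l: "l = p * ((z + 1) powr (p - 1) - z powr (p - 1))"
    using DERIV_unique[OF z(3)] by (simp add: right_diff_distrib)
  have rho: "rho h k = l / 2"
    unfolding rho_def z(4)[symmetric] p_def[symmetric] by simp
  have "z powr (p - 1) < (z + 1) powr (p - 1)"
    using z0 p by (intro powr_less_mono2) auto
  then show "0 < rho h k" unfolding rho l using p by simp
  have "(z + 1) powr (p - 1) - z powr (p - 1) \<le> ((z + 1) - z) * (z + 1) powr (p - 1 - 1)"
    using z0 p by (intro powr_diff_le) auto
  also have "\<dots> \<le> real k powr (p - 2)"
    using z0 z p k by (simp, intro powr_mono2') auto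
  finally show "rho h k \<le> h * real k powr (2*h - 2)"
    unfolding rho l p(3) using p(1) by (subst p(4)) (simp add: mult_left_mono)
qed

lemma sum_rho: "(\<Sum>k<n. rho h (Suc k)) = ((real n + 1) powr (2*h) - real n powr (2*h) - 1) / 2"
  by (induction n) (auto simp: rho_def add_ac diff_divide_distrib add_divide_distrib)

lemma sum_rho_at_top:
  assumes "1/2 < h"
  shows "filterlim (\<lambda>n. \<Sum>k<n. rho h (Suc k)) at_top sequentially"
proof (rule filterlim_at_top_mono)
  show "filterlim (\<lambda>n. (real n powr (2*h - 1) - 1) / 2) at_top sequentially"
    using assms by real_asymp
  show "\<forall>\<^sub>F n in sequentially. (real n powr (2*h - 1) - 1) / 2 \<le> (\<Sum>k<n. rho h (Suc k))"
  proof (intro always_eventually allI)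
    fix n
    \<comment> \<open>Lowering all but one factor of the leading telescoped power from
      \<open>n + 1\<close> to \<open>n\<close> leaves a surplus \<open>n powr (2*h - 1)\<close>,
      which diverges.\<close>
    have "(real n + 1) * real n powr (2*h - 1) \<le> (real n + 1) * (real n + 1) powr (2*h - 1)"
      using assms by (intro mult_left_mono powr_mono2) auto
    also have "\<dots> = (real n + 1) powr (2*h)" by (simp add: powr_diff)
    finally have "real n powr (2*h - 1) \<le> (real n + 1) powr (2*h) - real n powr (2*h)"
      by (cases "n = 0") (auto simp: powr_diff add_divide_distrib distrib_right)
    then show "(real n powr (2*h - 1) - 1) / 2 \<le> (\<Sum>k<n. rho h (Suc k))"
      unfolding sum_rho by simp
  qed
qed

section \<open>Convolutions of powers\<close>

lemma summable_Suc_powr: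
  assumes "p < -1"
  shows "summable (\<lambda>k. real (Suc k) powr p)"
  using assms summable_real_powr_iff[of p] by (subst summable_Suc_iff[of "\<lambda>k. real k powr p"]) simp

text \<open>With \<open>r = p + q - 2 d > 1\<close>, the term at \<open>(i, k)\<close> is at most
  \<open>(i k) powr (- d) * min i k powr (- r)\<close>, and \<open>i k \<ge> n - 1\<close> when \<open>i + k = n\<close>.\<close>

lemma powr_convolution_tendsto_0:
  fixes p q :: real
  assumes "0 < p" "0 < q" "1 < p + q"
  shows "(\<lambda>n. \<Sum>i=1..n-1. real i powr (- p) * real (n - i) powr (- q)) \<longlonglongrightarrow> 0"
proof -
  \<comment> \<open>The final halving makes all constraints strict: \<open>p - d\<close> and
    \<open>q - d\<close> stay positive, so both remaining powers are decreasing, and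
    \<open>r\<close> stays above 1.\<close>
  define d where "d = min (min p q) ((p + q - 1) / 2) / 2"
  have d: "0 < d" "d < p" "d < q" "2 * d < p + q - 1"
    using assms unfolding d_def by (auto simp: min_def)
  define r where "r = p + q - 2*d"
  have r: "1 < r" using d by (simp add: r_def)
  define Z where "Z = (\<Sum>k. real (Suc k) powr (- r))"
  have summ: "summable (\<lambda>k. real (Suc k) powr (- r))"
    using summable_Suc_powr[of "-r"] r by simp
  have part: "(\<Sum>i=1..n-1. real i powr (- r)) \<le> Z" for n
  proof -
    have "(\<Sum>i=1..n-1. real i powr (- r)) = (\<Sum>k<n-1. real (Suc k) powr (- r))"
      by (rule sum.reindex_bij_witness[of _ Suc "\<lambda>i. i - 1"]) auto
    also have "\<dots> \<le> Z" unfolding Z_def by (rule sum_le_suminf[OF summ]) auto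
    finally show ?thesis .
  qed
  have summand_le: "real i powr (- p) * real (n - i) powr (- q)
      \<le> (real n - 1) powr (- d) * (real i powr (- r) + real (n - i) powr (- r))"
    if i: "i \<in> {1..n-1}" for i n
  proof -
    define k where "k = n - i"
    have k: "1 \<le> k" "n = i + k" "1 \<le> i" using i by (auto simp: k_def)
    have ik: "real n - 1 \<le> real i * real k"
    proof -
      have "0 \<le> (real i - 1) * (real k - 1)" using k by simp
      then show ?thesis by (simp add: k(2) algebra_simps)
    qed
    have mm: "real i powr (- (p - d)) * real k powr (- (q - d)) \<le> real i powr (- r) + real k powr (- r)"
    proof (cases "i \<le> k")
      case True
      have "real i powr (- (p - d)) * real k powr (- (q - d)) \<le> real i powr (- (p - d)) * real i powr (- (q - d))"
        using True k d by (intro mult_left_mono powr_mono2') auto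
      also have "\<dots> = real i powr (- r)" by (simp add: r_def algebra_simps flip: powr_add)
      finally show ?thesis by (simp add: add_increasing2)
    next
      case False
      have "real i powr (- (p - d)) * real k powr (- (q - d)) \<le> real k powr (- (p - d)) * real k powr (- (q - d))"
        using False k d by (intro mult_right_mono powr_mono2') auto
      also have "\<dots> = real k powr (- r)" by (simp add: r_def algebra_simps flip: powr_add)
      finally show ?thesis by (simp add: add_increasing)
    qed
    have "real i powr (- p) * real k powr (- q)
        = (real i * real k) powr (- d) * (real i powr (- (p - d)) * real k powr (- (q - d)))"
    proof -
      have "real i powr (- p) = real i powr (- d) * real i powr (- (p - d))"
        "real k powr (- q) = real k powr (- d) * real k powr (- (q - d))"
        by (simp_all flip: powr_add)
      then show ?thesis by (simp add: powr_mult mult_ac)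
    qed
    also have "\<dots> \<le> (real n - 1) powr (- d) * (real i powr (- r) + real k powr (- r))"
      using ik k d mm by (intro mult_mono powr_mono2') auto
    finally show ?thesis unfolding k_def .
  qed
  show ?thesis
  proof (rule tendsto_sandwich[OF _ _ tendsto_const])
    show "\<forall>\<^sub>F n in sequentially. 0 \<le> (\<Sum>i=1..n-1. real i powr (- p) * real (n - i) powr (- q))"
      by (intro always_eventually allI sum_nonneg) auto
    show "\<forall>\<^sub>F n in sequentially. (\<Sum>i=1..n-1. real i powr (- p) * real (n - i) powr (- q))
        \<le> (real n - 1) powr (- d) * (2 * Z)"
    proof (intro always_eventually allI)
      fix n
      have "(\<Sum>i=1..n-1. real i powr (- p) * real (n - i) powr (- q))
          \<le> (\<Sum>i=1..n-1. (real n - 1) powr (- d) * (real i powr (- r) + real (n - i) powr (- r)))"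
        by (rule sum_mono) (rule summand_le)
      also have "\<dots> = (real n - 1) powr (- d) * ((\<Sum>i=1..n-1. real i powr (- r)) + (\<Sum>i=1..n-1. real (n - i) powr (- r)))"
        by (simp add: sum.distrib flip: sum_distrib_left)
      also have "(\<Sum>i=1..n-1. real (n - i) powr (- r)) = (\<Sum>i=1..n-1. real i powr (- r))"
        by (rule sum.reindex_bij_witness[of _ "\<lambda>i. n - i" "\<lambda>i. n - i"]) auto
      also have "(real n - 1) powr (- d) * ((\<Sum>i=1..n-1. real i powr (- r)) + (\<Sum>i=1..n-1. real i powr (- r)))
          \<le> (real n - 1) powr (- d) * (2 * Z)"
        using part[of n] by (intro mult_left_mono) auto
      finally show "(\<Sum>i=1..n-1. real i powr (- p) * real (n - i) powr (- q))
        \<le> (real n - 1) powr (- d) * (2 * Z)" .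
    qed
    show "(\<lambda>n. (real n - 1) powr (- d) * (2 * Z)) \<longlonglongrightarrow> 0"
      using d by real_asymp
  qed
qed

section \<open>Rademacher series\<close>

interpretation Rad_product: product_prob_space "\<lambda>_::nat. measure_pmf (pmf_of_set {-1::real, 1})" UNIV
  by unfold_locales

interpretation Rad: prob_space Rad
  unfolding Rad_def by unfold_locales

lemma space_Rad [simp]: "space Rad = UNIV"
  by (simp add: Rad_def space_PiM)

lemma measurable_Rad_component [measurable]: "(\<lambda>\<xi>. \<xi> k) \<in> borel_measurable Rad"
proof -
  have "(\<lambda>\<xi>. \<xi> k) \<in> Rad \<rightarrow>\<^sub>M measure_pmf (pmf_of_set {-1::real, 1})"
    unfolding Rad_def by measurable
  from measurable_compose[OF this, of "\<lambda>x. x" borel] show ?thesis by simp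
qed

lemma AE_Rad_sign: "AE \<xi> in Rad. \<forall>k. \<xi> k \<in> {-1, 1}"
  unfolding AE_all_countable Rad_def
  by (intro allI Rad_product.AE_component) (auto simp: AE_measure_pmf_iff set_pmf_of_set)

lemma measurable_Rad_flip:
  "(\<lambda>\<xi> k. s k * \<xi> k) \<in> Rad \<rightarrow>\<^sub>M Rad" for s :: "nat \<Rightarrow> real"
proof -
  have "(\<lambda>\<xi>. s k * \<xi> k) \<in> Rad \<rightarrow>\<^sub>M measure_pmf (pmf_of_set {-1::real, 1})" for k
  proof -
    have "(\<lambda>\<xi>. \<xi> k) \<in> Rad \<rightarrow>\<^sub>M measure_pmf (pmf_of_set {-1::real, 1})"
      unfolding Rad_def by measurable
    from measurable_compose[OF this, of "\<lambda>x. s k * x"] show ?thesis by simp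
  qed
  then have "(\<lambda>\<xi>. \<lambda>k\<in>UNIV. s k * \<xi> k) \<in> Rad \<rightarrow>\<^sub>M PiM UNIV (\<lambda>_. measure_pmf (pmf_of_set {-1::real, 1}))"
    by (intro measurable_restrict)
  then show ?thesis by (simp add: Rad_def restrict_UNIV)
qed

text \<open>A product measure is determined by cylinders, and each factor, uniform on two opposite
  signs, is preserved by multiplication with a sign.\<close>

lemma distr_Rad_flip:
  fixes s :: "nat \<Rightarrow> real"
  assumes s: "\<And>k. s k \<in> {-1, 1}"
  shows "distr Rad Rad (\<lambda>\<xi> k. s k * \<xi> k) = Rad"
  unfolding Rad_def
proof (rule Rad_product.PiM_eq)
  let ?p = "pmf_of_set {-1::real, 1}"
  fix J :: "nat set" and F :: "nat \<Rightarrow> real set"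
  assume J: "finite J"
  have inv: "emeasure ?p {x. s k * x \<in> A} = emeasure ?p A" for k A
  proof -
    have "map_pmf (\<lambda>x. s k * x) ?p = pmf_of_set ((\<lambda>x. s k * x) ` {-1, 1})"
      using s[of k] by (intro map_pmf_of_set_inj) (auto simp: inj_on_def)
    also have "(\<lambda>x. s k * x) ` {-1, 1} = {-1, 1}" using s[of k] by auto
    finally have m: "map_pmf (\<lambda>x. s k * x) ?p = ?p" .
    have "emeasure ?p {x. s k * x \<in> A} = emeasure (map_pmf (\<lambda>x. s k * x) ?p) A"
      by (simp add: vimage_def)
    then show ?thesis unfolding m .
  qed
  have ms: "prod_emb UNIV (\<lambda>_. measure_pmf ?p) J (Pi\<^sub>E J F) \<in> sets Rad"
    unfolding Rad_def using J by (intro sets_PiM_I) auto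
  have "emeasure (distr Rad Rad (\<lambda>\<xi> k. s k * \<xi> k)) (prod_emb UNIV (\<lambda>_. measure_pmf ?p) J (Pi\<^sub>E J F))
      = emeasure Rad (prod_emb UNIV (\<lambda>_. measure_pmf ?p) J (Pi\<^sub>E J (\<lambda>k. {x. s k * x \<in> F k})))"
    using ms by (subst emeasure_distr[OF measurable_Rad_flip])
      (auto simp: prod_emb_def space_PiM PiE_iff intro!: arg_cong[where f = "emeasure Rad"])
  also have "\<dots> = (\<Prod>k\<in>J. emeasure ?p {x. s k * x \<in> F k})"
    unfolding Rad_def using J by (intro Rad_product.emeasure_PiM_emb) auto
  finally show "emeasure (distr (Pi\<^sub>M UNIV (\<lambda>_. measure_pmf ?p)) (Pi\<^sub>M UNIV (\<lambda>_. measure_pmf ?p))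
      (\<lambda>\<xi> k. s k * \<xi> k)) (prod_emb UNIV (\<lambda>_. measure_pmf ?p) J (Pi\<^sub>E J F)) = (\<Prod>k\<in>J. emeasure ?p (F k))"
    unfolding inv Rad_def .
qed simp

lemma measure_Rad_flip:
  fixes s :: "nat \<Rightarrow> real"
  assumes "\<And>k. s k \<in> {-1, 1}" "Measurable.pred Rad P"
  shows "measure Rad {\<xi>. P (\<lambda>k. s k * \<xi> k)} = measure Rad {\<xi>. P \<xi>}"
proof -
  have "{\<xi>. P \<xi>} \<in> sets Rad" using assms(2) by (simp add: pred_def)
  then have "measure (distr Rad Rad (\<lambda>\<xi> k. s k * \<xi> k)) {\<xi>. P \<xi>} = measure Rad {\<xi>. P (\<lambda>k. s k * \<xi> k)}"
    by (subst measure_distr[OF measurable_Rad_flip]) (auto simp: vimage_def)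
  then show ?thesis using distr_Rad_flip[OF assms(1)] by simp
qed

text \<open>This stands in for independence: a cross term containing the \<open>n\<close>-th sign
  once is odd under the flip of that sign, so its expectation vanishes.\<close>

lemma integral_Rad_odd:
  fixes s :: "nat \<Rightarrow> real" and f :: "(nat \<Rightarrow> real) \<Rightarrow> real"
  assumes "\<And>k. s k \<in> {-1, 1}" "f \<in> borel_measurable Rad" "\<And>\<xi>. f (\<lambda>k. s k * \<xi> k) = - f \<xi>"
  shows "integral\<^sup>L Rad f = 0"
proof -
  have "integral\<^sup>L Rad f = integral\<^sup>L (distr Rad Rad (\<lambda>\<xi> k. s k * \<xi> k)) f"
    using distr_Rad_flip[OF assms(1)] by simp
  also have "\<dots> = - integral\<^sup>L Rad f"
    using assms by (subst integral_distr[OF measurable_Rad_flip]) auto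
  finally show ?thesis by simp
qed

text \<open>Freezing the partial sums once they reach \<open>e\<close> turns the event that some partial sum up to time
  \<open>n\<close> reaches \<open>e\<close> into an event at time \<open>n\<close> alone, to which Markov's inequality applies.\<close>

primrec stopped_sum :: "(nat \<Rightarrow> real) \<Rightarrow> real \<Rightarrow> (nat \<Rightarrow> real) \<Rightarrow> nat \<Rightarrow> real" where
  "stopped_sum c e \<xi> 0 = 0"
| "stopped_sum c e \<xi> (Suc n) =
    (if e \<le> \<bar>stopped_sum c e \<xi> n\<bar> then stopped_sum c e \<xi> n else stopped_sum c e \<xi> n + c n * \<xi> n)"

lemma measurable_stopped_sum [measurable]: "(\<lambda>\<xi>. stopped_sum c e \<xi> n) \<in> borel_measurable Rad"
  by (induction n) auto

text \<open>Adaptedness: the value at time \<open>n\<close> ignores coordinate \<open>n\<close>,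
  hence survives the flip of that coordinate.\<close>

lemma stopped_sum_cong: "(\<And>k. k < n \<Longrightarrow> \<xi> k = \<eta> k) \<Longrightarrow> stopped_sum c e \<xi> n = stopped_sum c e \<eta> n"
  by (induction n) auto

lemma stopped_sum_bound:
  assumes "\<And>k. \<xi> k \<in> {-1, 1}"
  shows "\<bar>stopped_sum c e \<xi> n\<bar> \<le> (\<Sum>k<n. \<bar>c k\<bar>)"
proof (induction n)
  case (Suc n)
  have "\<bar>c n * \<xi> n\<bar> = \<bar>c n\<bar>" using assms[of n] by (auto simp: abs_mult)
  then show ?case using Suc abs_triangle_ineq[of "stopped_sum c e \<xi> n" "c n * \<xi> n"] by auto
qed simp

lemma stopped_sum_reaches:
  assumes "0 < e" "m \<le> n" "e \<le> \<bar>\<Sum>k<m. c k * \<xi> k\<bar>"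
  shows "e \<le> \<bar>stopped_sum c e \<xi> n\<bar>"
proof -
  \<comment> \<open>Invariant of the stopping rule: either the level is already reached and kept, or
    nothing has been frozen so far. The start uses that the empty sum lies below the positive
    \<open>e\<close>.\<close>
  have "e \<le> \<bar>stopped_sum c e \<xi> n\<bar> \<or>
      (stopped_sum c e \<xi> n = (\<Sum>k<n. c k * \<xi> k) \<and> (\<forall>m\<le>n. \<bar>\<Sum>k<m. c k * \<xi> k\<bar> < e))"
    using assms(1) by (induction n) (auto simp: le_Suc_eq)
  then show ?thesis using assms by force
qed

lemma integrable_stopped_sum_square: "integrable Rad (\<lambda>\<xi>. (stopped_sum c e \<xi> n)\<^sup>2)"
proof (rule Rad.integrable_const_bound)
  show "AE \<xi> in Rad. norm ((stopped_sum c e \<xi> n)\<^sup>2) \<le> (\<Sum>k<n. \<bar>c k\<bar>)\<^sup>2"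
    using AE_Rad_sign
  proof eventually_elim
    case (elim \<xi>)
    have "\<bar>stopped_sum c e \<xi> n\<bar>\<^sup>2 \<le> (\<Sum>k<n. \<bar>c k\<bar>)\<^sup>2"
      using elim by (intro power_mono stopped_sum_bound) auto
    then show ?case by simp
  qed
qed measurable

lemma expectation_stopped_sum_square:
  "(\<integral>\<xi>. (stopped_sum c e \<xi> n)\<^sup>2 \<partial>Rad) \<le> (\<Sum>k<n. (c k)\<^sup>2)"
proof (induction n)
  case (Suc n)
  let ?M = "\<lambda>\<xi>. stopped_sum c e \<xi> n"
  \<comment> \<open>The cross term in the square of the next value, switched off once the sum is
    frozen; it is odd in the \<open>n\<close>-th sign.\<close>
  define f where "f \<xi> = (if e \<le> \<bar>?M \<xi>\<bar> then 0 else 2 * c n * ?M \<xi> * \<xi> n)" for \<xi>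
  have [measurable]: "f \<in> borel_measurable Rad" unfolding f_def by measurable
  have f0: "integral\<^sup>L Rad f = 0"
  proof (rule integral_Rad_odd[of "\<lambda>k. if k = n then -1 else 1"])
    fix \<xi> :: "nat \<Rightarrow> real"
    have "?M (\<lambda>k. (if k = n then -1 else 1) * \<xi> k) = ?M \<xi>"
      by (rule stopped_sum_cong) auto
    then show "f (\<lambda>k. (if k = n then -1 else 1) * \<xi> k) = - f \<xi>"
      unfolding f_def by simp
  qed auto
  have fi: "integrable Rad f"
  proof (rule Rad.integrable_const_bound)
    show "AE \<xi> in Rad. norm (f \<xi>) \<le> 2 * \<bar>c n\<bar> * (\<Sum>k<n. \<bar>c k\<bar>)"
      using AE_Rad_sign
    proof eventually_elim
      case (elim \<xi>)
      have "\<bar>\<xi> n\<bar> = 1" using elim[rule_format, of n] by auto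
      moreover have "\<bar>?M \<xi>\<bar> \<le> (\<Sum>k<n. \<bar>c k\<bar>)" using elim by (intro stopped_sum_bound) auto
      ultimately show ?case unfolding f_def
        by (auto simp: abs_mult intro!: mult_left_mono mult_nonneg_nonneg sum_nonneg)
    qed
  qed measurable
  have "(\<integral>\<xi>. (stopped_sum c e \<xi> (Suc n))\<^sup>2 \<partial>Rad) \<le> (\<integral>\<xi>. ((?M \<xi>)\<^sup>2 + f \<xi>) + (c n)\<^sup>2 \<partial>Rad)"
  proof (rule integral_mono_AE)
    show "AE \<xi> in Rad. (stopped_sum c e \<xi> (Suc n))\<^sup>2 \<le> ((?M \<xi>)\<^sup>2 + f \<xi>) + (c n)\<^sup>2"
      using AE_Rad_sign
    proof eventually_elim
      case (elim \<xi>)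
      have "(\<xi> n)\<^sup>2 = 1" using elim[rule_format, of n] by auto
      then show ?case unfolding f_def by (auto simp: power2_sum power_mult_distrib)
    qed
  qed (use fi in \<open>auto simp del: stopped_sum.simps intro!: integrable_stopped_sum_square Bochner_Integration.integrable_add\<close>)
  also have "\<dots> = (\<integral>\<xi>. (?M \<xi>)\<^sup>2 \<partial>Rad) + (c n)\<^sup>2"
    using fi f0 by (simp add: integrable_stopped_sum_square Rad.prob_space[simplified])
  finally show ?case using Suc by simp
qed simp

lemma Rad_maximal_inequality_finite:
  assumes "0 < e"
  shows "measure Rad {\<xi>. \<exists>m\<le>n. e \<le> \<bar>\<Sum>k<m. c k * \<xi> k\<bar>} \<le> (\<Sum>k<n. (c k)\<^sup>2) / e\<^sup>2"
proof -
  have "measure Rad {\<xi>. \<exists>m\<le>n. e \<le> \<bar>\<Sum>k<m. c k * \<xi> k\<bar>}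
      \<le> measure Rad {\<xi>\<in>space Rad. e\<^sup>2 \<le> (stopped_sum c e \<xi> n)\<^sup>2}"
  proof (rule Rad.finite_measure_mono)
    show "{\<xi>. \<exists>m\<le>n. e \<le> \<bar>\<Sum>k<m. c k * \<xi> k\<bar>} \<subseteq> {\<xi>\<in>space Rad. e\<^sup>2 \<le> (stopped_sum c e \<xi> n)\<^sup>2}"
    proof safe
      fix \<xi> m assume "m \<le> n" "e \<le> \<bar>\<Sum>k<m. c k * \<xi> k\<bar>"
      then have "e \<le> \<bar>stopped_sum c e \<xi> n\<bar>" by (rule stopped_sum_reaches[OF assms])
      then have "e\<^sup>2 \<le> \<bar>stopped_sum c e \<xi> n\<bar>\<^sup>2" using assms by (intro power_mono) auto
      then show "e\<^sup>2 \<le> (stopped_sum c e \<xi> n)\<^sup>2" by simp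
    qed simp
  qed measurable
  also have "\<dots> \<le> (\<integral>\<xi>. (stopped_sum c e \<xi> n)\<^sup>2 \<partial>Rad) / e\<^sup>2"
    using assms by (intro integral_Markov_inequality_measure[of _ _ "{}"] integrable_stopped_sum_square) auto
  also have "\<dots> \<le> (\<Sum>k<n. (c k)\<^sup>2) / e\<^sup>2"
    by (intro divide_right_mono expectation_stopped_sum_square) auto
  finally show ?thesis .
qed

lemma Rad_maximal_inequality:
  assumes "0 < e" "summable (\<lambda>k. (c k)\<^sup>2)"
  shows "measure Rad {\<xi>. \<exists>m. e \<le> \<bar>\<Sum>k<m. c k * \<xi> k\<bar>} \<le> (\<Sum>k. (c k)\<^sup>2) / e\<^sup>2"
proof -
  let ?A = "\<lambda>n. {\<xi>\<in>space Rad. \<exists>m\<in>{..n}. e \<le> \<bar>\<Sum>k<m. c k * \<xi> k\<bar>}"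
  have "(\<lambda>n. measure Rad (?A n)) \<longlonglongrightarrow> measure Rad (\<Union>n. ?A n)"
  proof (rule Rad.finite_Lim_measure_incseq)
    have "?A n \<in> sets Rad" for n by measurable
    then show "range ?A \<subseteq> sets Rad" by blast
  qed (auto simp: incseq_def)
  moreover have "measure Rad (?A n) \<le> (\<Sum>k. (c k)\<^sup>2) / e\<^sup>2" for n
  proof -
    have "measure Rad (?A n) \<le> (\<Sum>k<n. (c k)\<^sup>2) / e\<^sup>2"
      using Rad_maximal_inequality_finite[OF assms(1), of n c] by (simp add: Bex_def)
    also have "\<dots> \<le> (\<Sum>k. (c k)\<^sup>2) / e\<^sup>2"
      using assms by (intro divide_right_mono sum_le_suminf) auto
    finally show ?thesis .
  qed
  ultimately have "measure Rad (\<Union>n. ?A n) \<le> (\<Sum>k. (c k)\<^sup>2) / e\<^sup>2"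
    by (intro LIMSEQ_le_const2) auto
  moreover have "(\<Union>n. ?A n) = {\<xi>. \<exists>m. e \<le> \<bar>\<Sum>k<m. c k * \<xi> k\<bar>}" by auto
  ultimately show ?thesis by simp
qed

section \<open>Almost sure convergence of the series\<close>

lemma Rad_tail_tendsto_0:
  assumes "0 < e" "summable (\<lambda>k. (c k)\<^sup>2)"
  shows "(\<lambda>m. measure Rad {\<xi>. \<exists>n\<ge>m. e \<le> \<bar>(\<Sum>k<n. c k * \<xi> k) - (\<Sum>k<m. c k * \<xi> k)\<bar>}) \<longlonglongrightarrow> 0"
proof (rule tendsto_sandwich[OF _ _ tendsto_const])
  let ?R = "\<lambda>m. ((\<Sum>k. (c k)\<^sup>2) - (\<Sum>k<m. (c k)\<^sup>2)) / e\<^sup>2"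
  have "?R \<longlonglongrightarrow> ((\<Sum>k. (c k)\<^sup>2) - (\<Sum>k. (c k)\<^sup>2)) / e\<^sup>2"
    using assms by (intro tendsto_intros summable_LIMSEQ) auto
  then show "?R \<longlonglongrightarrow> 0" by simp
  show "\<forall>\<^sub>F m in sequentially.
      measure Rad {\<xi>. \<exists>n\<ge>m. e \<le> \<bar>(\<Sum>k<n. c k * \<xi> k) - (\<Sum>k<m. c k * \<xi> k)\<bar>} \<le> ?R m"
  proof (intro always_eventually allI)
    fix m
    \<comment> \<open>Erasing the first \<open>m\<close> coefficients makes the partial sums of
      \<open>d\<close> equal to the increments after time \<open>m\<close>, so the maximal
      inequality applies to them.\<close>
    define d where "d k = (if k < m then 0 else c k)" for k
    have "(\<lambda>k. (c k)\<^sup>2 - (if k \<in> {..<m} then (c k)\<^sup>2 else 0)) sums ((\<Sum>k. (c k)\<^sup>2) - (\<Sum>k<m. (c k)\<^sup>2))"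
      using assms by (intro sums_diff summable_sums sums_If_finite_set) auto
    also have "(\<lambda>k. (c k)\<^sup>2 - (if k \<in> {..<m} then (c k)\<^sup>2 else 0)) = (\<lambda>k. (d k)\<^sup>2)"
      by (auto simp: d_def)
    finally have d: "(\<lambda>k. (d k)\<^sup>2) sums ((\<Sum>k. (c k)\<^sup>2) - (\<Sum>k<m. (c k)\<^sup>2))" .
    have dsum: "(\<Sum>k<n. d k * \<xi> k) = (\<Sum>k<n. c k * \<xi> k) - (\<Sum>k<m. c k * \<xi> k)" if "m \<le> n" for n \<xi>
      using that by (induction n rule: dec_induct) (auto simp: d_def)
    have "measure Rad {\<xi>. \<exists>n\<ge>m. e \<le> \<bar>(\<Sum>k<n. c k * \<xi> k) - (\<Sum>k<m. c k * \<xi> k)\<bar>}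
        \<le> measure Rad {\<xi>\<in>space Rad. \<exists>n. e \<le> \<bar>\<Sum>k<n. d k * \<xi> k\<bar>}"
    proof (rule Rad.finite_measure_mono)
      show "{\<xi>\<in>space Rad. \<exists>n. e \<le> \<bar>\<Sum>k<n. d k * \<xi> k\<bar>} \<in> sets Rad" by measurable
    qed (auto simp flip: dsum)
    also have "\<dots> \<le> (\<Sum>k. (d k)\<^sup>2) / e\<^sup>2"
      using Rad_maximal_inequality[OF assms(1), of d] d by (simp add: sums_iff)
    also have "\<dots> = ?R m" using d by (simp add: sums_iff)
    finally show "measure Rad {\<xi>. \<exists>n\<ge>m. e \<le> \<bar>(\<Sum>k<n. c k * \<xi> k) - (\<Sum>k<m. c k * \<xi> k)\<bar>} \<le> ?R m" .
  qed
qed auto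

lemma AE_Rad_summable:
  assumes "summable (\<lambda>k. (c k)\<^sup>2)"
  shows "AE \<xi> in Rad. summable (\<lambda>k. c k * \<xi> k)"
proof -
  let ?S = "\<lambda>\<xi> n. \<Sum>k<n. c k * \<xi> k"
  have "AE \<xi> in Rad. \<exists>m. \<forall>n\<in>{m..}. \<bar>?S \<xi> n - ?S \<xi> m\<bar> < e" if e: "0 < e" for e
  proof -
    let ?B = "{\<xi>\<in>space Rad. \<not> (\<exists>m. \<forall>n\<in>{m..}. \<bar>?S \<xi> n - ?S \<xi> m\<bar> < e)}"
    \<comment> \<open>Violating the Cauchy bound from every starting index places \<open>?B\<close>
      inside all tail events at once, and their probabilities tend to 0.\<close>
    have "measure Rad ?B \<le> measure Rad {\<xi>. \<exists>n\<ge>m. e \<le> \<bar>?S \<xi> n - ?S \<xi> m\<bar>}" for m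
    proof (rule Rad.finite_measure_mono)
      show "?B \<subseteq> {\<xi>. \<exists>n\<ge>m. e \<le> \<bar>?S \<xi> n - ?S \<xi> m\<bar>}" by (force simp: not_less)
      have "{\<xi>\<in>space Rad. \<exists>n\<in>{m..}. e \<le> \<bar>?S \<xi> n - ?S \<xi> m\<bar>} \<in> sets Rad" by measurable
      then show "{\<xi>. \<exists>n\<ge>m. e \<le> \<bar>?S \<xi> n - ?S \<xi> m\<bar>} \<in> sets Rad" by (simp add: Bex_def)
    qed
    then have "measure Rad ?B \<le> 0"
      by (intro LIMSEQ_le_const[OF Rad_tail_tendsto_0[OF e assms]]) auto
    then have "measure Rad ?B = 0" using measure_nonneg[of Rad ?B] by linarith
    moreover have "?B \<in> sets Rad" by measurable
    ultimately show ?thesis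
      by (intro AE_I[of _ _ ?B]) (auto simp: Rad.emeasure_eq_measure)
  qed
  then have "AE \<xi> in Rad. \<forall>j. \<exists>m. \<forall>n\<in>{m..}. \<bar>?S \<xi> n - ?S \<xi> m\<bar> < inverse (real (Suc j))"
    unfolding AE_all_countable by simp
  then show ?thesis
  proof eventually_elim
    case (elim \<xi>)
    have "Cauchy (?S \<xi>)"
      unfolding Cauchy_altdef2
    proof (intro allI impI)
      fix e :: real assume "0 < e"
      then obtain j where j: "inverse (real (Suc j)) < e" using reals_Archimedean by auto
      from elim obtain m where "\<forall>n\<in>{m..}. \<bar>?S \<xi> n - ?S \<xi> m\<bar> < inverse (real (Suc j))" by blast
      then show "\<exists>N. \<forall>n\<ge>N. dist (?S \<xi> n) (?S \<xi> N) < e"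
        using j by (intro exI[of _ m]) (force simp: dist_real_def)
    qed
    then show ?case
      by (simp add: summable_iff_convergent Cauchy_convergent_iff)
  qed
qed

lemma Rad_partial_sum_tendsto_in_measure:
  assumes "0 < e" "summable (\<lambda>k. (c k)\<^sup>2)"
  shows "(\<lambda>m. measure Rad {\<xi>. e \<le> \<bar>(\<Sum>k. c k * \<xi> k) - (\<Sum>k<m. c k * \<xi> k)\<bar>}) \<longlonglongrightarrow> 0"
proof (rule tendsto_sandwich[OF _ _ tendsto_const])
  let ?S = "\<lambda>\<xi> n. \<Sum>k<n. c k * \<xi> k"
  \<comment> \<open>Halving \<open>e\<close> leaves room for the limit: a limiting distance of at
    least \<open>e\<close> forces late partial sums beyond \<open>e/2\<close>, while possibly none
    of them reaches \<open>e\<close>.\<close>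
  show "(\<lambda>m. measure Rad {\<xi>. \<exists>n\<ge>m. e/2 \<le> \<bar>?S \<xi> n - ?S \<xi> m\<bar>}) \<longlonglongrightarrow> 0"
    using assms by (intro Rad_tail_tendsto_0) auto
  show "\<forall>\<^sub>F m in sequentially. measure Rad {\<xi>. e \<le> \<bar>(\<Sum>k. c k * \<xi> k) - ?S \<xi> m\<bar>}
      \<le> measure Rad {\<xi>. \<exists>n\<ge>m. e/2 \<le> \<bar>?S \<xi> n - ?S \<xi> m\<bar>}"
  proof (rule always_eventually, rule allI, rule Rad.finite_measure_mono_AE)
    fix m
    show "AE \<xi> in Rad. \<xi> \<in> {\<xi>. e \<le> \<bar>(\<Sum>k. c k * \<xi> k) - ?S \<xi> m\<bar>} \<longrightarrow>
        \<xi> \<in> {\<xi>. \<exists>n\<ge>m. e/2 \<le> \<bar>?S \<xi> n - ?S \<xi> m\<bar>}"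
      using AE_Rad_summable[OF assms(2)]
    proof eventually_elim
      case (elim \<xi>)
      have lim: "(\<lambda>n. \<bar>?S \<xi> n - ?S \<xi> m\<bar>) \<longlonglongrightarrow> \<bar>(\<Sum>k. c k * \<xi> k) - ?S \<xi> m\<bar>"
        using elim by (intro tendsto_intros summable_LIMSEQ)
      show ?case
      proof (unfold mem_Collect_eq, rule impI)
        assume "e \<le> \<bar>(\<Sum>k. c k * \<xi> k) - ?S \<xi> m\<bar>"
        then have "e / 2 < \<bar>(\<Sum>k. c k * \<xi> k) - ?S \<xi> m\<bar>" using assms by simp
        from order_tendstoD(1)[OF lim this] obtain n0 where
          "\<forall>n\<ge>n0. e / 2 < \<bar>?S \<xi> n - ?S \<xi> m\<bar>" by (auto simp: eventually_sequentially)
        then show "\<exists>n\<ge>m. e / 2 \<le> \<bar>?S \<xi> n - ?S \<xi> m\<bar>"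
          by (intro exI[of _ "max n0 m"]) (simp add: less_imp_le)
      qed
    qed
    have "{\<xi>\<in>space Rad. \<exists>n\<in>{m..}. e/2 \<le> \<bar>?S \<xi> n - ?S \<xi> m\<bar>} \<in> sets Rad" by measurable
    then show "{\<xi>. \<exists>n\<ge>m. e/2 \<le> \<bar>?S \<xi> n - ?S \<xi> m\<bar>} \<in> sets Rad" by (simp add: Bex_def)
  qed
qed auto

text \<open>Flipping the \<open>j\<close>-th sign moves the sum by \<open>2 \<bar>c j\<bar>\<close>. Flips at indices with distinct \<open>\<bar>c j\<bar>\<close>
  therefore carry an atom to pairwise disjoint events of equal probability.\<close>

lemma Rad_series_no_atom:
  assumes c: "summable (\<lambda>k. (c k)\<^sup>2)" and inf: "infinite (range (\<lambda>k. \<bar>c k\<bar>))"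
  shows "measure Rad {\<xi>. (\<Sum>k. c k * \<xi> k) = x} = 0"
proof -
  let ?Y = "\<lambda>\<xi>. \<Sum>k. c k * \<xi> k"
  define fl :: "nat \<Rightarrow> (nat \<Rightarrow> real) \<Rightarrow> nat \<Rightarrow> real" where "fl j \<xi> = (\<lambda>k. (if k = j then -1 else 1) * \<xi> k)" for j \<xi>
  have [measurable]: "fl j \<in> Rad \<rightarrow>\<^sub>M Rad" for j
    unfolding fl_def by (rule measurable_Rad_flip)
  have Y_fl: "?Y (fl j \<xi>) = ?Y \<xi> - 2 * c j * \<xi> j" if "summable (\<lambda>k. c k * \<xi> k)" for j \<xi>
  proof -
    have "(\<lambda>k. c k * \<xi> k - (if k = j then 2 * c k * \<xi> k else 0)) sums (?Y \<xi> - 2 * c j * \<xi> j)"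
      using that by (intro sums_diff summable_sums sums_single) auto
    also have "(\<lambda>k. c k * \<xi> k - (if k = j then 2 * c k * \<xi> k else 0)) = (\<lambda>k. c k * fl j \<xi> k)"
      by (auto simp: fl_def)
    finally show ?thesis by (simp add: sums_iff)
  qed
  \<comment> \<open>\<open>K\<close> selects one index for each value of
    \<open>\<bar>c k\<bar>\<close>, so it is infinite and the moduli are distinct on it.\<close>
  obtain K where K: "inj_on (\<lambda>k. \<bar>c k\<bar>) K" "range (\<lambda>k. \<bar>c k\<bar>) = (\<lambda>k. \<bar>c k\<bar>) ` K"
    using subset_image_inj[of "range (\<lambda>k. \<bar>c k\<bar>)" "\<lambda>k. \<bar>c k\<bar>" UNIV] by auto
  have "infinite K" using K inf by auto
  have "AE \<xi> in Rad. (\<forall>k. \<xi> k \<in> {-1, 1}) \<and> summable (\<lambda>k. c k * \<xi> k)"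
    using AE_Rad_sign AE_Rad_summable[OF c] by eventually_elim auto
  then obtain Nl where Nl: "{\<xi>\<in>space Rad. \<not> ((\<forall>k. \<xi> k \<in> {-1, 1}) \<and> summable (\<lambda>k. c k * \<xi> k))} \<subseteq> Nl"
      "Nl \<in> sets Rad" "emeasure Rad Nl = 0"
    by (rule AE_E)
  \<comment> \<open>Discarding one common null set makes the events genuinely disjoint: outside it
    every coordinate is a sign and the series converges, so a flip shifts the sum exactly.\<close>
  define B where "B j = {\<xi>\<in>space Rad. ?Y (fl j \<xi>) = x} - Nl" for j
  let ?p = "measure Rad {\<xi>. ?Y \<xi> = x}"
  have Bs: "{\<xi>\<in>space Rad. ?Y (fl j \<xi>) = x} \<in> sets Rad" for j by measurable
  have B_sets: "B j \<in> sets Rad" for j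
    unfolding B_def using Bs Nl(2) by (rule sets.Diff)
  have B_meas: "measure Rad (B j) = ?p" for j
  proof -
    have "measure Rad (B j) = measure Rad {\<xi>\<in>space Rad. ?Y (fl j \<xi>) = x}"
      unfolding B_def using Bs Nl(2,3) by (intro measure_Diff_null_set) auto
    also have "\<dots> = ?p"
      unfolding fl_def space_Rad using measure_Rad_flip[of "\<lambda>k. if k = j then -1 else 1" "\<lambda>\<xi>. ?Y \<xi> = x"] by simp
    finally show ?thesis .
  qed
  have disj: "B i \<inter> B j = {}" if "i \<in> K" "j \<in> K" "i \<noteq> j" for i j
  proof (rule ccontr)
    assume "B i \<inter> B j \<noteq> {}"
    then obtain \<xi> where \<xi>: "\<xi> \<notin> Nl" "?Y (fl i \<xi>) = x" "?Y (fl j \<xi>) = x" by (auto simp: B_def)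
    then have g: "\<And>k. \<xi> k \<in> {-1, 1}" "summable (\<lambda>k. c k * \<xi> k)" using Nl(1) by auto
    have "c i * \<xi> i = c j * \<xi> j" using \<xi> Y_fl[OF g(2)] by simp
    then have "\<bar>c i\<bar> * \<bar>\<xi> i\<bar> = \<bar>c j\<bar> * \<bar>\<xi> j\<bar>" by (simp flip: abs_mult)
    moreover have "\<bar>\<xi> i\<bar> = 1" "\<bar>\<xi> j\<bar> = 1" using g(1)[of i] g(1)[of j] by auto
    ultimately show False using K(1) that by (auto simp: inj_on_def)
  qed
  have "real n * ?p \<le> 1" for n
  proof -
    obtain F where F: "finite F" "card F = n" "F \<subseteq> K"
      using infinite_arbitrarily_large[OF \<open>infinite K\<close>] by blast
    have "real n * ?p = (\<Sum>j\<in>F. measure Rad (B j))" using F by (simp add: B_meas)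
    also have "\<dots> = measure Rad (\<Union>j\<in>F. B j)"
    proof (rule Rad.finite_measure_finite_Union[symmetric])
      show "disjoint_family_on B F"
        unfolding disjoint_family_on_def using F(3) disj by blast
    qed (use F B_sets in auto)
    also have "\<dots> \<le> 1" by (rule Rad.prob_le_1)
    finally show ?thesis .
  qed
  show ?thesis
  proof (rule ccontr)
    assume "?p \<noteq> 0"
    then have "0 < ?p" using measure_nonneg[of Rad "{\<xi>. ?Y \<xi> = x}"] by linarith
    then obtain n where "1 < real n * ?p" using reals_Archimedean3 by blast
    then show False using \<open>real n * ?p \<le> 1\<close> by simp
  qed
qed

section \<open>Counting sign strings by probabilities\<close>

lemma measure_Rad_cylinder:
  assumes "finite J" "\<And>k. k \<in> J \<Longrightarrow> x k \<in> {-1, 1}"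
  shows "measure Rad {\<xi>. \<forall>k\<in>J. \<xi> k = x k} = (1/2) ^ card J"
proof -
  have "emeasure Rad {\<xi>. \<forall>k\<in>J. \<xi> k = x k} = (\<Prod>k\<in>J. emeasure (pmf_of_set {-1::real, 1}) {x k})"
    using Rad_product.emeasure_PiM_Collect[of J "\<lambda>k. {x k}"] assms(1)
    unfolding Rad_def[symmetric] by simp
  also have "\<dots> = (\<Prod>k\<in>J. ennreal (1/2))"
    using assms by (intro prod.cong refl) (auto simp: emeasure_pmf_single)
  also have "\<dots> = ennreal (\<Prod>k\<in>J. 1/2)" by (rule prod_ennreal) simp
  finally show ?thesis by (simp add: measure_def)
qed

text \<open>The list is read backwards because the coefficient of \<open>x_i\<close> is governed by
  the distance \<open>n - i\<close>. With \<open>m = n - 1\<close>, position \<open>i - 1\<close>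
  carries coordinate \<open>n - i\<close>, so each coordinate keeps a coefficient that converges as
  \<open>n\<close> grows. Coordinates run from \<open>m\<close> down to 1.\<close>

lemma measure_Rad_signs:
  assumes A: "A \<subseteq> {xs. length xs = m \<and> set xs \<subseteq> {-1, 1}}"
  shows "measure Rad {\<xi>. map (\<lambda>j. \<xi> (m - j)) [0..<m] \<in> A} = real (card A) / 2 ^ m"
    and "{\<xi>. map (\<lambda>j. \<xi> (m - j)) [0..<m] \<in> A} \<in> sets Rad"
proof -
  have "finite {xs :: real list. set xs \<subseteq> {-1, 1} \<and> length xs = m}"
    by (rule finite_lists_length_eq) auto
  then have fin: "finite A" using A by (elim finite_subset[rotated]) auto
  define C where "C xs = {\<xi>::nat \<Rightarrow> real. \<forall>k\<in>{1..m}. \<xi> k = xs ! (m - k)}" for xs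
  have C_eq: "map (\<lambda>j. \<xi> (m - j)) [0..<m] = xs \<longleftrightarrow> \<xi> \<in> C xs" if "length xs = m" for \<xi> xs
  proof -
    have "map (\<lambda>j. \<xi> (m - j)) [0..<m] = xs \<longleftrightarrow> (\<forall>j<m. \<xi> (m - j) = xs ! j)"
      using that by (auto simp: list_eq_iff_nth_eq)
    also have "\<dots> \<longleftrightarrow> (\<forall>k\<in>{1..m}. \<xi> k = xs ! (m - k))"
    proof safe
      fix k assume "\<forall>j<m. \<xi> (m - j) = xs ! j" "k \<in> {1..m}"
      then show "\<xi> k = xs ! (m - k)" by (auto dest: spec[of _ "m - k"])
    next
      fix j assume "\<forall>k\<in>{1..m}. \<xi> k = xs ! (m - k)" "j < m"
      then show "\<xi> (m - j) = xs ! j" by (auto dest: bspec[of _ _ "m - j"])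
    qed
    finally show ?thesis by (simp add: C_def)
  qed
  have U: "{\<xi>. map (\<lambda>j. \<xi> (m - j)) [0..<m] \<in> A} = (\<Union>xs\<in>A. C xs)"
  proof (intro set_eqI)
    fix \<xi>
    have "\<xi> \<in> C xs \<longleftrightarrow> map (\<lambda>j. \<xi> (m - j)) [0..<m] = xs" if "xs \<in> A" for xs
      using C_eq[of xs \<xi>] A that by auto
    then show "\<xi> \<in> {\<xi>. map (\<lambda>j. \<xi> (m - j)) [0..<m] \<in> A} \<longleftrightarrow> \<xi> \<in> (\<Union>xs\<in>A. C xs)" by auto
  qed
  have Cs: "C xs \<in> sets Rad" for xs
  proof -
    have "{\<xi>\<in>space Rad. \<forall>k\<in>{1..m}. \<xi> k = xs ! (m - k)} \<in> sets Rad" by measurable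
    then show ?thesis by (simp add: C_def)
  qed
  show "{\<xi>. map (\<lambda>j. \<xi> (m - j)) [0..<m] \<in> A} \<in> sets Rad"
    unfolding U using fin Cs by auto
  have "disjoint_family_on C A"
    unfolding disjoint_family_on_def
  proof (intro ballI impI equals0I)
    fix xs ys \<xi> assume "xs \<in> A" "ys \<in> A" "xs \<noteq> ys" "\<xi> \<in> C xs \<inter> C ys"
    moreover from this have "length xs = m" "length ys = m" using A by auto
    ultimately show False using C_eq[of xs \<xi>] C_eq[of ys \<xi>] by simp
  qed
  then have "measure Rad (\<Union>xs\<in>A. C xs) = (\<Sum>xs\<in>A. measure Rad (C xs))"
    using fin Cs by (intro Rad.finite_measure_finite_Union) auto
  also have "\<dots> = (\<Sum>xs\<in>A. (1/2) ^ m)"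
  proof (rule sum.cong[OF refl])
    fix xs assume "xs \<in> A"
    then have "length xs = m" "set xs \<subseteq> {-1, 1}" using A by auto
    then have "xs ! (m - k) \<in> {-1, 1}" if "k \<in> {1..m}" for k
    proof -
      have "m - k < length xs" using that \<open>length xs = m\<close> by auto
      from nth_mem[OF this] show ?thesis using \<open>set xs \<subseteq> {-1, 1}\<close> by blast
    qed
    then show "measure Rad (C xs) = (1/2) ^ m"
      unfolding C_def by (subst measure_Rad_cylinder) auto
  qed
  finally show "measure Rad {\<xi>. map (\<lambda>j. \<xi> (m - j)) [0..<m] \<in> A} = real (card A) / 2 ^ m"
    unfolding U by (simp add: power_one_over)
qed

text \<open>On the event that the first \<open>n\<close> signs are \<open>1\<close>, flipping all later signs reflects the sum at
  \<open>\<Sum>k<n. c k\<close>, so it is at least this value with conditional probability at least \<open>1/2\<close>.\<close>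

lemma Rad_series_exceeds:
  assumes c: "summable (\<lambda>k. (c k)\<^sup>2)" and t: "t < (\<Sum>k<n. c k)"
  shows "0 < measure Rad {\<xi>. t < (\<Sum>k. c k * \<xi> k)}"
proof -
  let ?Y = "\<lambda>\<xi>. \<Sum>k. c k * \<xi> k"
  define s :: "nat \<Rightarrow> real" where "s k = (if k < n then 1 else -1)" for k
  have Y_fl: "?Y (\<lambda>k. s k * \<xi> k) = 2 * (\<Sum>k<n. c k * \<xi> k) - ?Y \<xi>" if "summable (\<lambda>k. c k * \<xi> k)" for \<xi>
  proof -
    have "(\<lambda>k. (if k \<in> {..<n} then 2 * (c k * \<xi> k) else 0) - c k * \<xi> k) sums ((\<Sum>k<n. 2 * (c k * \<xi> k)) - ?Y \<xi>)"
      using that by (intro sums_diff summable_sums sums_If_finite_set) auto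
    also have "(\<lambda>k. (if k \<in> {..<n} then 2 * (c k * \<xi> k) else 0) - c k * \<xi> k) = (\<lambda>k. c k * (s k * \<xi> k))"
      by (auto simp: s_def)
    finally show ?thesis by (simp add: sums_iff sum_distrib_left)
  qed
  define Q where "Q \<xi> \<longleftrightarrow> (\<forall>k\<in>{..<n}. \<xi> k = 1) \<and> (\<Sum>k<n. c k) \<le> ?Y \<xi>" for \<xi>
  have Qm [measurable]: "Measurable.pred Rad Q" unfolding Q_def by measurable
  have Qfm: "Measurable.pred Rad (\<lambda>\<xi>. Q (\<lambda>k. s k * \<xi> k))"
    using measurable_Rad_flip Qm by (rule measurable_compose)
  have "(1/2) ^ n = measure Rad {\<xi>. \<forall>k\<in>{..<n}. \<xi> k = 1}"
    by (subst measure_Rad_cylinder) auto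
  also have "\<dots> \<le> measure Rad ({\<xi>. Q \<xi>} \<union> {\<xi>. Q (\<lambda>k. s k * \<xi> k)})"
  proof (rule Rad.finite_measure_mono_AE)
    show "AE \<xi> in Rad. \<xi> \<in> {\<xi>. \<forall>k\<in>{..<n}. \<xi> k = 1} \<longrightarrow> \<xi> \<in> {\<xi>. Q \<xi>} \<union> {\<xi>. Q (\<lambda>k. s k * \<xi> k)}"
      using AE_Rad_summable[OF c]
    proof eventually_elim
      case (elim \<xi>)
      show ?case
      proof
        assume a: "\<xi> \<in> {\<xi>. \<forall>k\<in>{..<n}. \<xi> k = 1}"
        then have "(\<Sum>k<n. c k * \<xi> k) = (\<Sum>k<n. c k)" by (intro sum.cong) auto
        then show "\<xi> \<in> {\<xi>. Q \<xi>} \<union> {\<xi>. Q (\<lambda>k. s k * \<xi> k)}"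
          using a Y_fl[OF elim] by (auto simp: Q_def s_def)
      qed
    qed
    show "{\<xi>. Q \<xi>} \<union> {\<xi>. Q (\<lambda>k. s k * \<xi> k)} \<in> sets Rad"
      using Qm Qfm by (simp add: pred_def sets.Un)
  qed
  also have "\<dots> \<le> measure Rad {\<xi>. Q \<xi>} + measure Rad {\<xi>. Q (\<lambda>k. s k * \<xi> k)}"
    using Qm Qfm by (intro measure_Un_le) (auto simp: pred_def)
  also have "\<dots> = 2 * measure Rad {\<xi>. Q \<xi>}"
    using measure_Rad_flip[OF _ Qm, of s] by (simp add: s_def)
  also have "measure Rad {\<xi>. Q \<xi>} \<le> measure Rad {\<xi>\<in>space Rad. t < ?Y \<xi>}"
  proof (rule Rad.finite_measure_mono)
    show "{\<xi>\<in>space Rad. t < ?Y \<xi>} \<in> sets Rad" by measurable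
  qed (use t in \<open>auto simp: Q_def\<close>)
  finally have "(1/2) ^ n \<le> 2 * measure Rad {\<xi>. t < ?Y \<xi>}" by simp
  moreover have "0 < (1/2 :: real) ^ n" by simp
  ultimately show ?thesis by linarith
qed

section \<open>Convergence of the threshold probabilities\<close>

lemma threshold_stable:
  fixes X Y G g e d :: real
  assumes X: "\<bar>X - Y\<bar> < d / 2" and G: "\<bar>G - g\<bar> < d / 4" and e: "\<bar>e\<bar> < d / 4" and Y: "d < \<bar>\<bar>Y\<bar> - g\<bar>"
  shows "X + G \<le> e \<or> e \<le> X - G \<longleftrightarrow> g < \<bar>Y\<bar>"
proof -
  \<comment> \<open>The three perturbations spend \<open>d/2\<close>, \<open>d/4\<close> and
    \<open>d/4\<close>, together the whole margin \<open>d\<close> that separates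
    \<open>\<bar>Y\<bar>\<close> from \<open>g\<close>.\<close>
  have *: "X < Y + d / 2" "Y - d / 2 < X" "G < g + d / 4" "g - d / 4 < G" "e < d / 4" "- d / 4 < e"
    using X G e by linarith+
  show ?thesis
  proof (cases "g < \<bar>Y\<bar>")
    case True
    then have "g + d < \<bar>Y\<bar>" using Y by simp
    then have "g + d < Y \<or> Y < - g - d" by (cases "0 \<le> Y") auto
    then show ?thesis using True * by linarith
  next
    case False
    then have "\<bar>Y\<bar> < g - d" using Y by simp
    then have "Y < g - d" "d - g < Y" by (simp_all add: abs_less_iff)
    then show ?thesis using False * by linarith
  qed
qed

text \<open>The two events agree outside three exceptional ones: the limit is close to its threshold
  (\<open>D\<close>), the series has a large tail (\<open>U\<close>), or the change of coefficients
  matters (\<open>V\<close>). The first is rare by the absence of atoms, the others by the second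
  moment bounds.\<close>

lemma Rad_series_threshold_limit:
  fixes \<beta> :: "nat \<Rightarrow> nat \<Rightarrow> real"
  assumes c: "summable (\<lambda>k. (c k)\<^sup>2)" and inf: "infinite (range (\<lambda>k. \<bar>c k\<bar>))"
    and \<beta>: "(\<lambda>n. \<Sum>k<n. (\<beta> n k - c k)\<^sup>2) \<longlonglongrightarrow> 0"
    and G: "G \<longlonglongrightarrow> g" and E: "\<epsilon> \<longlonglongrightarrow> 0"
  shows "(\<lambda>n. measure Rad {\<xi>. (\<Sum>k<n. \<beta> n k * \<xi> k) + G n \<le> \<epsilon> n \<or> \<epsilon> n \<le> (\<Sum>k<n. \<beta> n k * \<xi> k) - G n})
    \<longlonglongrightarrow> measure Rad {\<xi>. g < \<bar>\<Sum>k. c k * \<xi> k\<bar>}"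
proof -
  let ?Y = "\<lambda>\<xi>. \<Sum>k. c k * \<xi> k"
  let ?X = "\<lambda>n \<xi>. \<Sum>k<n. \<beta> n k * \<xi> k"
  let ?S = "\<lambda>n \<xi>. \<Sum>k<n. c k * \<xi> k"
  define D where "D d = {\<xi>\<in>space Rad. \<bar>\<bar>?Y \<xi>\<bar> - g\<bar> \<le> d}" for d
  define U where "U d n = {\<xi>\<in>space Rad. d \<le> \<bar>?Y \<xi> - ?S n \<xi>\<bar>}" for d n
  \<comment> \<open>The event runs over all \<open>m\<close> up to \<open>n\<close> to match the
    finite maximal inequality; its instance \<open>m = n\<close> is the distance between
    \<open>?X n\<close> and \<open>?S n\<close>.\<close>
  define V where "V d n = {\<xi>\<in>space Rad. \<exists>m\<in>{..n}. d \<le> \<bar>\<Sum>k<m. (\<beta> n k - c k) * \<xi> k\<bar>}" for d n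
  define F where "F = {\<xi>\<in>space Rad. g < \<bar>?Y \<xi>\<bar>}"
  define A where "A n = {\<xi>\<in>space Rad. ?X n \<xi> + G n \<le> \<epsilon> n \<or> \<epsilon> n \<le> ?X n \<xi> - G n}" for n
  have sets_all: "D d \<in> sets Rad" "U d n \<in> sets Rad" "V d n \<in> sets Rad" "F \<in> sets Rad" "A n \<in> sets Rad" for d n
    unfolding D_def U_def V_def F_def A_def by measurable
  have "(\<lambda>j. measure Rad (D (inverse (real (Suc j))))) \<longlonglongrightarrow> measure Rad (\<Inter>j. D (inverse (real (Suc j))))"
  proof (rule Rad.finite_Lim_measure_decseq)
    show "decseq (\<lambda>j. D (inverse (real (Suc j))))"
    proof (rule decseq_SucI)
      fix j
      have "inverse (real (Suc (Suc j))) \<le> inverse (real (Suc j))" by (intro le_imp_inverse_le) auto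
      then show "D (inverse (real (Suc (Suc j)))) \<subseteq> D (inverse (real (Suc j)))"
        unfolding D_def by (blast intro: order_trans)
    qed
  qed (use sets_all in auto)
  moreover have "measure Rad (\<Inter>j. D (inverse (real (Suc j)))) = 0"
  proof -
    have "(\<Inter>j. D (inverse (real (Suc j)))) \<subseteq> {\<xi>. ?Y \<xi> = g} \<union> {\<xi>. ?Y \<xi> = - g}"
    proof
      fix \<xi> assume a: "\<xi> \<in> (\<Inter>j. D (inverse (real (Suc j))))"
      have "\<bar>\<bar>?Y \<xi>\<bar> - g\<bar> = 0"
      proof (rule ccontr)
        assume "\<bar>\<bar>?Y \<xi>\<bar> - g\<bar> \<noteq> 0"
        then obtain j where "inverse (real (Suc j)) < \<bar>\<bar>?Y \<xi>\<bar> - g\<bar>"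
          using reals_Archimedean[of "\<bar>\<bar>?Y \<xi>\<bar> - g\<bar>"] by auto
        moreover have "\<xi> \<in> D (inverse (real (Suc j)))" using a by blast
        ultimately show False by (simp add: D_def)
      qed
      then show "\<xi> \<in> {\<xi>. ?Y \<xi> = g} \<union> {\<xi>. ?Y \<xi> = - g}" by auto
    qed
    moreover have ms: "{\<xi>\<in>space Rad. ?Y \<xi> = x} \<in> sets Rad" for x by measurable
    ultimately have "measure Rad (\<Inter>j. D (inverse (real (Suc j)))) \<le> measure Rad ({\<xi>. ?Y \<xi> = g} \<union> {\<xi>. ?Y \<xi> = - g})"
      by (intro Rad.finite_measure_mono) auto
    also have "\<dots> \<le> measure Rad {\<xi>. ?Y \<xi> = g} + measure Rad {\<xi>. ?Y \<xi> = - g}"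
      using ms by (intro measure_Un_le) auto
    also have "\<dots> = 0" using Rad_series_no_atom[OF c inf] by simp
    finally show ?thesis by (simp add: measure_le_0_iff)
  qed
  ultimately have D0: "(\<lambda>j. measure Rad (D (inverse (real (Suc j))))) \<longlonglongrightarrow> 0" by simp
  have U0: "(\<lambda>n. measure Rad (U d n)) \<longlonglongrightarrow> 0" if "0 < d" for d
    unfolding U_def using Rad_partial_sum_tendsto_in_measure[OF that c] by simp
  have V0: "(\<lambda>n. measure Rad (V d n)) \<longlonglongrightarrow> 0" if "0 < d" for d
  proof (rule tendsto_sandwich[OF _ _ tendsto_const])
    show "(\<lambda>n. (\<Sum>k<n. (\<beta> n k - c k)\<^sup>2) / d\<^sup>2) \<longlonglongrightarrow> 0"
      using tendsto_divide_zero[OF \<beta>, of "d\<^sup>2"] by simp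
    show "\<forall>\<^sub>F n in sequentially. measure Rad (V d n) \<le> (\<Sum>k<n. (\<beta> n k - c k)\<^sup>2) / d\<^sup>2"
    proof (intro always_eventually allI)
      fix n
      show "measure Rad (V d n) \<le> (\<Sum>k<n. (\<beta> n k - c k)\<^sup>2) / d\<^sup>2"
        using Rad_maximal_inequality_finite[OF that, of n "\<lambda>k. \<beta> n k - c k"]
        by (simp add: V_def Bex_def)
    qed
  qed auto
  have "(\<lambda>n. measure Rad (A n)) \<longlonglongrightarrow> measure Rad F"
  proof (rule LIMSEQ_I)
    fix r :: real assume r: "0 < r"
    then have "0 < r / 3" by simp
    \<comment> \<open>The margin is fixed first, from the law of the limit alone; only then is
      \<open>n\<close> taken large enough for that margin.\<close>
    from order_tendstoD(2)[OF D0 this] obtain j where j: "measure Rad (D (inverse (real (Suc j)))) < r / 3"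
      by (auto simp: eventually_sequentially)
    define d where "d = inverse (real (Suc j))"
    have d: "0 < d" by (simp add: d_def)
    have "\<forall>\<^sub>F n in sequentially. \<bar>G n - g\<bar> < d / 4"
      using tendstoD[OF G, of "d / 4"] d by (simp add: dist_real_def)
    moreover have "\<forall>\<^sub>F n in sequentially. \<bar>\<epsilon> n\<bar> < d / 4"
      using tendstoD[OF E, of "d / 4"] d by (simp add: dist_real_def)
    moreover have "\<forall>\<^sub>F n in sequentially. measure Rad (U (d / 4) n) < r / 3"
      using U0[of "d / 4"] d r by (intro order_tendstoD(2)) auto
    moreover have "\<forall>\<^sub>F n in sequentially. measure Rad (V (d / 4) n) < r / 3"
      using V0[of "d / 4"] d r by (intro order_tendstoD(2)) auto
    ultimately have "\<forall>\<^sub>F n in sequentially. \<bar>measure Rad (A n) - measure Rad F\<bar> < r"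
    proof eventually_elim
      case (elim n)
      let ?R = "D d \<union> (U (d / 4) n \<union> V (d / 4) n)"
      have key: "\<xi> \<in> A n \<longleftrightarrow> \<xi> \<in> F" if "\<xi> \<notin> ?R" for \<xi>
      proof -
        have "\<not> d / 4 \<le> \<bar>\<Sum>k<n. (\<beta> n k - c k) * \<xi> k\<bar>" using that by (auto simp: V_def)
        then have v: "\<bar>?X n \<xi> - ?S n \<xi>\<bar> < d / 4" by (simp add: left_diff_distrib sum_subtractf)
        have "\<bar>?Y \<xi> - ?S n \<xi>\<bar> < d / 4" "d < \<bar>\<bar>?Y \<xi>\<bar> - g\<bar>" using that by (auto simp: U_def D_def)
        with v have "\<bar>?X n \<xi> - ?Y \<xi>\<bar> < d / 2" "d < \<bar>\<bar>?Y \<xi>\<bar> - g\<bar>" by linarith+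
        from threshold_stable[OF this(1) elim(1,2) this(2)] show ?thesis
          unfolding A_def F_def space_Rad by simp
      qed
      have R: "measure Rad ?R < r"
      proof -
        have "measure Rad ?R \<le> measure Rad (D d) + measure Rad (U (d / 4) n \<union> V (d / 4) n)"
          using sets_all by (intro measure_Un_le) auto
        also have "measure Rad (U (d / 4) n \<union> V (d / 4) n) \<le> measure Rad (U (d / 4) n) + measure Rad (V (d / 4) n)"
          using sets_all by (intro measure_Un_le) auto
        finally show ?thesis using elim(3,4) j unfolding d_def[symmetric] by simp
      qed
      have Rs: "?R \<in> sets Rad" using sets_all by auto
      have "measure Rad (A n) \<le> measure Rad (F \<union> ?R)"
        by (rule Rad.finite_measure_mono[OF subsetI], use key in blast) (rule sets.Un[OF sets_all(4) Rs])
      also have "\<dots> \<le> measure Rad F + measure Rad ?R" using sets_all Rs by (intro measure_Un_le) auto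
      finally have 1: "measure Rad (A n) \<le> measure Rad F + measure Rad ?R" .
      have "measure Rad F \<le> measure Rad (A n \<union> ?R)"
        by (rule Rad.finite_measure_mono[OF subsetI], use key in blast) (rule sets.Un[OF sets_all(5) Rs])
      also have "\<dots> \<le> measure Rad (A n) + measure Rad ?R" using sets_all Rs by (intro measure_Un_le) auto
      finally show ?case using 1 R by linarith
    qed
    then show "\<exists>no. \<forall>n\<ge>no. norm (measure Rad (A n) - measure Rad F) < r"
      by (auto simp: eventually_sequentially)
  qed
  then show ?thesis by (simp add: A_def F_def)
qed

section \<open>The binary tree\<close>

text \<open>The coefficients of \<open>YH\<close>, indexed by the coordinates of \<open>Rad\<close>, of which the \<open>0\<close>-th is unused.\<close>

definition YH_coeff :: "real \<Rightarrow> real \<Rightarrow> nat \<Rightarrow> real" where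
  "YH_coeff H \<sigma> k = (if k = 0 then 0 else 2 * gH H \<sigma> * rho (hpar H) k)"

context
  fixes H \<sigma> :: real
  assumes H: "1/2 < H" "H < 1" and sigma: "0 < \<sigma>"
begin

lemma hpar_bounds: "1/2 < hpar H" "hpar H \<le> 1" "2 * hpar H - 2 = H - 3/2"
  using H by (auto simp: hpar_def)

lemma YH_coeff_bounds:
  assumes "1 \<le> k"
  shows "0 < YH_coeff H \<sigma> k" "YH_coeff H \<sigma> k \<le> 2 * gH H \<sigma> * hpar H * real k powr (H - 3/2)"
  using rho_bounds[OF hpar_bounds(1,2) assms] gH_pos[OF H sigma] assms hpar_bounds(3)
  by (auto simp: YH_coeff_def mult.assoc)

lemma summable_YH_coeff_square: "summable (\<lambda>k. (YH_coeff H \<sigma> k)\<^sup>2)"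
proof -
  have "summable (\<lambda>k. (2 * gH H \<sigma> * hpar H)\<^sup>2 * real (Suc k) powr (2*H - 3))"
    using H by (intro summable_mult summable_Suc_powr) auto
  then have "summable (\<lambda>k. (YH_coeff H \<sigma> (Suc k))\<^sup>2)"
  proof (rule summable_comparison_test'[where N = 0])
    fix k :: nat
    have "(YH_coeff H \<sigma> (Suc k))\<^sup>2 \<le> (2 * gH H \<sigma> * hpar H * real (Suc k) powr (H - 3/2))\<^sup>2"
      using YH_coeff_bounds[of "Suc k"] by (intro power_mono) auto
    also have "\<dots> = (2 * gH H \<sigma> * hpar H)\<^sup>2 * real (Suc k) powr (2*H - 3)"
      by (simp add: power_mult_distrib powr_power algebra_simps)
    finally show "norm ((YH_coeff H \<sigma> (Suc k))\<^sup>2) \<le> (2 * gH H \<sigma> * hpar H)\<^sup>2 * real (Suc k) powr (2*H - 3)"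
      by simp
  qed
  then show ?thesis by (subst (asm) summable_Suc_iff)
qed

text \<open>Positive coefficients tending to 0 cannot take finitely many values, since a least
  positive value would bound them away from 0.\<close>

lemma infinite_range_YH_coeff: "infinite (range (\<lambda>k. \<bar>YH_coeff H \<sigma> k\<bar>))"
proof
  let ?R = "range (\<lambda>k. \<bar>YH_coeff H \<sigma> k\<bar>) - {0}"
  assume "finite (range (\<lambda>k. \<bar>YH_coeff H \<sigma> k\<bar>))"
  then have fin: "finite ?R" by simp
  have in_R: "YH_coeff H \<sigma> k \<in> ?R" if "1 \<le> k" for k
    using YH_coeff_bounds(1)[OF that] by (auto intro: image_eqI[of _ _ k])
  then have ne: "?R \<noteq> {}" by blast
  have "Min ?R \<in> ?R" using fin ne by (rule Min_in)
  then have "0 < Min ?R" by auto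
  have "(\<lambda>k. (YH_coeff H \<sigma> k)\<^sup>2) \<longlonglongrightarrow> 0"
    by (rule summable_LIMSEQ_zero[OF summable_YH_coeff_square])
  from order_tendstoD(2)[OF this, of "(Min ?R)\<^sup>2"] \<open>0 < Min ?R\<close>
  have "\<forall>\<^sub>F k in sequentially. (YH_coeff H \<sigma> k)\<^sup>2 < (Min ?R)\<^sup>2" by simp
  then have "\<forall>\<^sub>F k in sequentially. (YH_coeff H \<sigma> k)\<^sup>2 < (Min ?R)\<^sup>2 \<and> 1 \<le> k"
    using eventually_ge_at_top[of 1] by eventually_elim auto
  then obtain k where k: "(YH_coeff H \<sigma> k)\<^sup>2 < (Min ?R)\<^sup>2" "1 \<le> k"
    by (auto simp: eventually_sequentially)
  have "Min ?R \<le> YH_coeff H \<sigma> k" using fin in_R[OF k(2)] by (rule Min_le)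
  then have "(Min ?R)\<^sup>2 \<le> (YH_coeff H \<sigma> k)\<^sup>2" using \<open>0 < Min ?R\<close> by (intro power_mono) auto
  then show False using k by simp
qed

lemma measurable_YH: "YH H \<sigma> \<in> borel_measurable Rad"
  unfolding YH_def by measurable

text \<open>Shifting the index and pulling out the factor are legitimate only where the series
  converges, hence the identity is almost sure.\<close>

lemma AE_YH_eq: "AE \<xi> in Rad. YH H \<sigma> \<xi> = (\<Sum>k. YH_coeff H \<sigma> k * \<xi> k)"
  using AE_Rad_summable[OF summable_YH_coeff_square]
proof eventually_elim
  case (elim \<xi>)
  have eq: "YH_coeff H \<sigma> (Suc k) * \<xi> (Suc k) = 2 * gH H \<sigma> * (rho (hpar H) (Suc k) * \<xi> (Suc k))" for k
    by (simp add: YH_coeff_def)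
  have "summable (\<lambda>k. YH_coeff H \<sigma> (Suc k) * \<xi> (Suc k))"
    using elim by (subst summable_Suc_iff)
  then have "summable (\<lambda>k. rho (hpar H) (Suc k) * \<xi> (Suc k))"
    using gH_pos[OF H sigma] unfolding eq by (simp add: summable_cmult_iff)
  then have "YH H \<sigma> \<xi> = (\<Sum>k. YH_coeff H \<sigma> (Suc k) * \<xi> (Suc k))"
    unfolding YH_def eq by (rule suminf_mult[symmetric])
  also have "\<dots> = (\<Sum>k. YH_coeff H \<sigma> k * \<xi> k)"
    using suminf_split_head[OF elim] by (simp add: YH_coeff_def)
  finally show ?case .
qed

lemma measure_YH_eq:
  "measure Rad {\<xi>\<in>space Rad. \<bar>YH H \<sigma> \<xi>\<bar> > g} = measure Rad {\<xi>. g < \<bar>\<Sum>k. YH_coeff H \<sigma> k * \<xi> k\<bar>}"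
proof (rule Rad.finite_measure_eq_AE)
  show "AE \<xi> in Rad. \<xi> \<in> {\<xi>\<in>space Rad. \<bar>YH H \<sigma> \<xi>\<bar> > g} \<longleftrightarrow>
      \<xi> \<in> {\<xi>. g < \<bar>\<Sum>k. YH_coeff H \<sigma> k * \<xi> k\<bar>}"
    using AE_YH_eq by eventually_elim simp
  show "{\<xi>\<in>space Rad. \<bar>YH H \<sigma> \<xi>\<bar> > g} \<in> sets Rad"
    using measurable_YH by measurable
  have "{\<xi>\<in>space Rad. g < \<bar>\<Sum>k. YH_coeff H \<sigma> k * \<xi> k\<bar>} \<in> sets Rad" by measurable
  then show "{\<xi>. g < \<bar>\<Sum>k. YH_coeff H \<sigma> k * \<xi> k\<bar>} \<in> sets Rad" by simp
qed

lemma YH_exceeds_pos: "0 < measure Rad {\<xi>\<in>space Rad. \<bar>YH H \<sigma> \<xi>\<bar> > g}"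
proof -
  have "filterlim (\<lambda>n. 2 * gH H \<sigma> * (\<Sum>k<n. rho (hpar H) (Suc k))) at_top sequentially"
    using gH_pos[OF H sigma] hpar_bounds
    by (intro filterlim_tendsto_pos_mult_at_top[OF tendsto_const] sum_rho_at_top) auto
  then have "\<forall>\<^sub>F n in sequentially. g < 2 * gH H \<sigma> * (\<Sum>k<n. rho (hpar H) (Suc k))"
    by (simp add: filterlim_at_top_dense)
  then obtain n where "g < 2 * gH H \<sigma> * (\<Sum>k<n. rho (hpar H) (Suc k))"
    by (auto simp: eventually_sequentially)
  also have "\<dots> = (\<Sum>k<Suc n. YH_coeff H \<sigma> k)"
    by (simp add: sum.lessThan_Suc_shift sum_distrib_left YH_coeff_def del: sum.lessThan_Suc)
  finally have "0 < measure Rad {\<xi>. g < (\<Sum>k. YH_coeff H \<sigma> k * \<xi> k)}"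
    by (rule Rad_series_exceeds[OF summable_YH_coeff_square])
  also have "\<dots> \<le> measure Rad {\<xi>\<in>space Rad. g < \<bar>\<Sum>k. YH_coeff H \<sigma> k * \<xi> k\<bar>}"
  proof (rule Rad.finite_measure_mono)
    show "{\<xi>\<in>space Rad. g < \<bar>\<Sum>k. YH_coeff H \<sigma> k * \<xi> k\<bar>} \<in> sets Rad" by measurable
  qed auto
  finally show ?thesis unfolding measure_YH_eq by simp
qed

text \<open>Multiplying both inequalities by the positive \<open>N powr H\<close> and substituting
  \<open>k = n - i\<close> gives a signed sum in the coordinates \<open>1\<close> to
  \<open>n - 1\<close>; \<open>\<beta> 0 = 0\<close> pads it to \<open>k < n\<close>. The events
  agree almost surely because coordinates of \<open>Rad\<close> are signs only up to a null
  set.\<close>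

lemma card_An_eq:
  assumes n: "1 \<le> n" "n \<le> N"
  defines "\<beta> \<equiv> \<lambda>k. if k = 0 then 0 else real N powr H * Jn H \<sigma> N n (n - k)"
  shows "real (card (An H \<sigma> a N n)) / 2 ^ (n - 1) = measure Rad {\<xi>.
      (\<Sum>k<n. \<beta> k * \<xi> k) + real N powr H * gn H \<sigma> N n \<le> - (real N powr H * an a N n) \<or>
      - (real N powr H * an a N n) \<le> (\<Sum>k<n. \<beta> k * \<xi> k) - real N powr H * gn H \<sigma> N n}"
    (is "_ = measure Rad ?E")
proof -
  let ?L = "\<lambda>\<xi>::nat \<Rightarrow> real. map (\<lambda>j. \<xi> (n - 1 - j)) [0..<n - 1]"
  have sub: "An H \<sigma> a N n \<subseteq> {xs. length xs = n - 1 \<and> set xs \<subseteq> {-1, 1}}"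
    by (auto simp: An_def)
  note S = measure_Rad_signs[OF sub]
  have W: "0 < real N powr H" using n by simp
  have Y: "real N powr H * Yn H \<sigma> N n (?L \<xi>) = (\<Sum>k<n. \<beta> k * \<xi> k)" for \<xi>
  proof -
    have "real N powr H * Yn H \<sigma> N n (?L \<xi>) = (\<Sum>i=1..n-1. real N powr H * Jn H \<sigma> N n i * \<xi> (n - i))"
      unfolding Yn_def sum_distrib_left by (intro sum.cong) (auto simp: mult.assoc)
    also have "\<dots> = (\<Sum>k=1..n-1. \<beta> k * \<xi> k)"
      by (rule sum.reindex_bij_witness[of _ "\<lambda>k. n - k" "\<lambda>i. n - i"]) (auto simp: \<beta>_def)
    also have "\<dots> = (\<Sum>k<n. \<beta> k * \<xi> k)"
      using n by (intro sum.mono_neutral_left) (auto simp: \<beta>_def)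
    finally show ?thesis .
  qed
  have "measure Rad {\<xi>. ?L \<xi> \<in> An H \<sigma> a N n} = measure Rad ?E"
  proof (rule Rad.finite_measure_eq_AE)
    show "AE \<xi> in Rad. \<xi> \<in> {\<xi>. ?L \<xi> \<in> An H \<sigma> a N n} \<longleftrightarrow> \<xi> \<in> ?E"
      using AE_Rad_sign
    proof eventually_elim
      case (elim \<xi>)
      have "set (?L \<xi>) \<subseteq> {-1, 1}" using elim by auto
      then have "?L \<xi> \<in> An H \<sigma> a N n \<longleftrightarrow>
          un H \<sigma> N n (?L \<xi>) \<le> - an a N n \<or> - an a N n \<le> dn H \<sigma> N n (?L \<xi>)"
        by (auto simp: An_def)
      also have "\<dots> \<longleftrightarrow> real N powr H * un H \<sigma> N n (?L \<xi>) \<le> real N powr H * (- an a N n) \<or>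
          real N powr H * (- an a N n) \<le> real N powr H * dn H \<sigma> N n (?L \<xi>)"
        by (simp only: mult_le_cancel_left_pos[OF W])
      also have "\<dots> \<longleftrightarrow> \<xi> \<in> ?E"
        unfolding un_def dn_def distrib_left right_diff_distrib Y by simp
      finally show ?case by simp
    qed
    have "{\<xi>\<in>space Rad. (\<Sum>k<n. \<beta> k * \<xi> k) + real N powr H * gn H \<sigma> N n \<le> - (real N powr H * an a N n) \<or>
      - (real N powr H * an a N n) \<le> (\<Sum>k<n. \<beta> k * \<xi> k) - real N powr H * gn H \<sigma> N n} \<in> sets Rad"
      by measurable
    then show "?E \<in> sets Rad" by simp
  qed (rule S)
  then show ?thesis using S(1) by simp
qed

lemma An_density_limit:
  fixes a :: "real \<Rightarrow> real" and Nseq :: "nat \<Rightarrow> nat"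
  assumes a: "continuous_on {0..1} a" and N: "\<And>n. n \<le> Nseq n"
  shows "(\<lambda>n. real (card (An H \<sigma> a (Nseq n) n)) / 2 ^ (n - 1))
    \<longlonglongrightarrow> measure Rad {\<xi>\<in>space Rad. \<bar>YH H \<sigma> \<xi>\<bar> > gH H \<sigma>}"
proof -
  define \<beta> where "\<beta> n k = (if k = 0 then 0 else real (Nseq n) powr H * Jn H \<sigma> (Nseq n) n (n - k))" for n k
  define G where "G n = real (Nseq n) powr H * gn H \<sigma> (Nseq n) n" for n
  define \<epsilon> where "\<epsilon> n = - (real (Nseq n) powr H * an a (Nseq n) n)" for n
  define K where "K = \<sigma> * cH H / (3 - 2*H)"
  have \<beta>lim: "(\<lambda>n. \<Sum>k<n. (\<beta> n k - YH_coeff H \<sigma> k)\<^sup>2) \<longlonglongrightarrow> 0"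
  proof (rule tendsto_sandwich[OF _ _ tendsto_const])
    \<comment> \<open>The exponents are those of the squared error factors. They add up to
      \<open>3 - 2*H\<close>, which exceeds 1 exactly because \<open>H < 1\<close>.\<close>
    let ?C = "\<lambda>n. \<Sum>i=1..n-1. real i powr (- (2*H - 1)) * real (n - i) powr (- (4 - 4*H))"
    show "(\<lambda>n. K\<^sup>2 * ?C n) \<longlonglongrightarrow> 0"
      using H by (intro tendsto_mult_right_zero powr_convolution_tendsto_0) auto
    show "\<forall>\<^sub>F n in sequentially. (\<Sum>k<n. (\<beta> n k - YH_coeff H \<sigma> k)\<^sup>2) \<le> K\<^sup>2 * ?C n"
      using eventually_ge_at_top[of 1]
    proof eventually_elim
      case (elim n)
      have "(\<Sum>k<n. (\<beta> n k - YH_coeff H \<sigma> k)\<^sup>2) = (\<Sum>k=1..n-1. (\<beta> n k - YH_coeff H \<sigma> k)\<^sup>2)"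
        using elim by (intro sum.mono_neutral_right) (auto simp: \<beta>_def YH_coeff_def)
      also have "\<dots> = (\<Sum>i=1..n-1. (\<beta> n (n - i) - YH_coeff H \<sigma> (n - i))\<^sup>2)"
        by (rule sum.reindex_bij_witness[of _ "\<lambda>i. n - i" "\<lambda>i. n - i"]) auto
      also have "\<dots> \<le> (\<Sum>i=1..n-1. K\<^sup>2 * (real i powr (- (2*H - 1)) * real (n - i) powr (- (4 - 4*H))))"
      proof (rule sum_mono)
        fix i assume i: "i \<in> {1..n-1}"
        then have i': "1 \<le> i" "i < n" "n - i \<noteq> 0" "n - (n - i) = i" by auto
        note J = Jn_bounds[OF H sigma i'(1,2) N[of n]]
        have "0 \<le> \<beta> n (n - i) - YH_coeff H \<sigma> (n - i)"
          "\<beta> n (n - i) - YH_coeff H \<sigma> (n - i) \<le> K * (real (n - i) powr (2*H - 2) * real i powr (1/2 - H))"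
          using J i' unfolding K_def by (simp_all add: \<beta>_def YH_coeff_def)
        then have "(\<beta> n (n - i) - YH_coeff H \<sigma> (n - i))\<^sup>2
            \<le> (K * (real (n - i) powr (2*H - 2) * real i powr (1/2 - H)))\<^sup>2"
          by (intro power_mono)
        also have "\<dots> = K\<^sup>2 * ((real i powr (1/2 - H))\<^sup>2 * (real (n - i) powr (2*H - 2))\<^sup>2)"
          by (simp add: power_mult_distrib mult_ac)
        also have "(real i powr (1/2 - H))\<^sup>2 = real i powr (- (2*H - 1))"
          by (simp add: power2_eq_square flip: powr_add)
        also have "(real (n - i) powr (2*H - 2))\<^sup>2 = real (n - i) powr (- (4 - 4*H))"
          by (simp add: power2_eq_square flip: powr_add)
        finally show "(\<beta> n (n - i) - YH_coeff H \<sigma> (n - i))\<^sup>2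
            \<le> K\<^sup>2 * (real i powr (- (2*H - 1)) * real (n - i) powr (- (4 - 4*H)))" .
      qed
      finally show ?case by (simp add: sum_distrib_left)
    qed
  qed (auto intro!: always_eventually sum_nonneg)
  have Glim: "G \<longlonglongrightarrow> gH H \<sigma>"
  proof (rule tendsto_sandwich)
    show "\<forall>\<^sub>F n in sequentially. gH H \<sigma> \<le> G n"
      using eventually_ge_at_top[of 1]
      by eventually_elim (simp add: G_def gn_bounds(1)[OF H sigma _ N])
    show "\<forall>\<^sub>F n in sequentially. G n \<le> gH H \<sigma> + K * real n powr (1/2 - H)"
      using eventually_ge_at_top[of 1]
      by eventually_elim (use gn_bounds(2)[OF H sigma _ N] in \<open>simp add: G_def K_def\<close>)
    have "(\<lambda>n. real n powr (1/2 - H)) \<longlonglongrightarrow> 0"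
      using H by (intro tendsto_neg_powr filterlim_real_sequentially) auto
    from tendsto_add[OF tendsto_const tendsto_mult_right_zero[OF this, of K], of "gH H \<sigma>"]
    show "(\<lambda>n. gH H \<sigma> + K * real n powr (1/2 - H)) \<longlonglongrightarrow> gH H \<sigma>" by simp
  qed simp
  have "bounded (a ` {0..1})"
    using compact_imp_bounded[OF compact_continuous_image[OF a compact_Icc]] .
  then obtain B where "\<forall>x\<in>a ` {0..1}. norm x \<le> B" unfolding bounded_iff by blast
  then have B: "\<bar>a t\<bar> \<le> B" if "t \<in> {0..1}" for t using that by force
  have Elim: "\<epsilon> \<longlonglongrightarrow> 0"
  proof (rule Lim_null_comparison)
    show "\<forall>\<^sub>F n in sequentially. norm (\<epsilon> n) \<le> B * real n powr (H - 1)"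
      using eventually_ge_at_top[of 1]
    proof eventually_elim
      case (elim n)
      have Nn: "0 < real (Nseq n)" "real n \<le> real (Nseq n)" using elim N[of n] by auto
      \<comment> \<open>The factor \<open>1/N\<close> in the drift leaves
        \<open>N powr (H - 1)\<close>. As this exponent is negative and \<open>N \<ge> n\<close>,
        the bound depends on \<open>n\<close> only.\<close>
      have "norm (\<epsilon> n) = \<bar>a (real n / real (Nseq n))\<bar> * real (Nseq n) powr (H - 1)"
        using Nn by (simp add: \<epsilon>_def an_def abs_mult powr_diff)
      also have "\<dots> \<le> B * real n powr (H - 1)"
        using Nn elim H B[of "real n / real (Nseq n)"]
        by (intro mult_mono powr_mono2') (auto intro: order_trans[OF abs_ge_zero B[of 0]])
      finally show ?case .
    qed
    have "(\<lambda>n. real n powr (H - 1)) \<longlonglongrightarrow> 0"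
      using H by (intro tendsto_neg_powr filterlim_real_sequentially) auto
    then show "(\<lambda>n. B * real n powr (H - 1)) \<longlonglongrightarrow> 0" by (rule tendsto_mult_right_zero)
  qed
  have "(\<lambda>n. measure Rad {\<xi>. (\<Sum>k<n. \<beta> n k * \<xi> k) + G n \<le> \<epsilon> n \<or> \<epsilon> n \<le> (\<Sum>k<n. \<beta> n k * \<xi> k) - G n})
      \<longlonglongrightarrow> measure Rad {\<xi>\<in>space Rad. \<bar>YH H \<sigma> \<xi>\<bar> > gH H \<sigma>}"
    unfolding measure_YH_eq
    by (rule Rad_series_threshold_limit[OF summable_YH_coeff_square infinite_range_YH_coeff \<beta>lim Glim Elim])
  then show ?thesis
  proof (rule Lim_transform_eventually)
    show "\<forall>\<^sub>F n in sequentially.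
      measure Rad {\<xi>. (\<Sum>k<n. \<beta> n k * \<xi> k) + G n \<le> \<epsilon> n \<or> \<epsilon> n \<le> (\<Sum>k<n. \<beta> n k * \<xi> k) - G n}
        = real (card (An H \<sigma> a (Nseq n) n)) / 2 ^ (n - 1)"
      using eventually_ge_at_top[of 1]
      by eventually_elim (simp only: card_An_eq[OF _ N] \<beta>_def G_def \<epsilon>_def)
  qed
qed

end

section \<open>From single levels to the whole tree\<close>

lemma uniform_limit_from_sequences:
  fixes q :: "nat \<Rightarrow> nat \<Rightarrow> real"
  assumes "\<And>f. (\<And>n. n \<le> f n) \<Longrightarrow> (\<lambda>n. q (f n) n) \<longlonglongrightarrow> L" and "0 < e"
  shows "\<exists>n0. \<forall>n\<ge>n0. \<forall>N\<ge>n. \<bar>q N n - L\<bar> < e"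
proof -
  \<comment> \<open>The adversarial sequence picks at each level some \<open>N\<close> violating the
    bound whenever one exists. Convergence along it excludes violations at all late levels.\<close>
  define f where "f n = (if \<exists>N\<ge>n. e \<le> \<bar>q N n - L\<bar> then SOME N. n \<le> N \<and> e \<le> \<bar>q N n - L\<bar> else n)" for n
  have f: "n \<le> f n \<and> ((\<exists>N\<ge>n. e \<le> \<bar>q N n - L\<bar>) \<longrightarrow> e \<le> \<bar>q (f n) n - L\<bar>)" for n
    using someI_ex[of "\<lambda>N. n \<le> N \<and> e \<le> \<bar>q N n - L\<bar>"] by (auto simp: f_def)
  then have "(\<lambda>n. q (f n) n) \<longlonglongrightarrow> L" by (intro assms(1)) auto
  from LIMSEQ_D[OF this assms(2)] obtain n0 where "\<forall>n\<ge>n0. \<bar>q (f n) n - L\<bar> < e" by auto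
  then show ?thesis using f by (metis not_le)
qed

text \<open>The weights sum to \<open>2 ^ N - 1\<close>, and the first \<open>n0\<close> levels
  carry a bounded share of this growing total. Since the averaged terms change with \<open>N\<close>
  too, late levels must be controlled uniformly.\<close>

lemma weighted_average_limit:
  fixes q :: "nat \<Rightarrow> nat \<Rightarrow> real"
  assumes unif: "\<And>e. 0 < e \<Longrightarrow> \<exists>n0. \<forall>n\<ge>n0. \<forall>N\<ge>n. \<bar>q N n - L\<bar> < e"
    and bnd: "\<And>N n. \<bar>q N n - L\<bar> \<le> B"
  shows "(\<lambda>N. (\<Sum>n=1..N. 2 ^ (n - 1) * q N n) / (2 ^ N - 1)) \<longlonglongrightarrow> L"
proof (rule LIMSEQ_I)
  have geo: "(\<Sum>n=1..N. 2 ^ (n - 1) :: real) = 2 ^ N - 1" for N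
    by (induction N) auto
  have B0: "0 \<le> B" using bnd[of 0 0] by simp
  fix r :: real assume r: "0 < r"
  then obtain n0 where n0: "\<And>n N. n0 \<le> n \<Longrightarrow> n \<le> N \<Longrightarrow> \<bar>q N n - L\<bar> < r / 2"
    using unif[of "r / 2"] by auto
  have "(\<lambda>N. B * 2 ^ n0 / (2 ^ N - 1) :: real) \<longlonglongrightarrow> 0" by real_asymp
  then have "\<forall>\<^sub>F N in sequentially. B * 2 ^ n0 / (2 ^ N - 1) < r / 2"
    using r by (intro order_tendstoD(2)) auto
  then have "\<forall>\<^sub>F N in sequentially. norm ((\<Sum>n=1..N. 2 ^ (n - 1) * q N n) / (2 ^ N - 1) - L) < r"
    using eventually_ge_at_top[of 1]
  proof eventually_elim
    case (elim N)
    have pos: "0 < (2 ^ N - 1 :: real)" using elim(2) by simp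
    have "(\<Sum>n=1..N. 2 ^ (n - 1) * q N n) / (2 ^ N - 1) - L
        = (\<Sum>n=1..N. 2 ^ (n - 1) * (q N n - L)) / (2 ^ N - 1)"
      using pos unfolding right_diff_distrib sum_subtractf sum_distrib_right[symmetric] geo
      by (simp add: field_simps)
    moreover have "\<bar>\<Sum>n=1..N. 2 ^ (n - 1) * (q N n - L)\<bar> \<le> B * 2 ^ n0 + r / 2 * (2 ^ N - 1)"
    proof -
      have "\<bar>\<Sum>n=1..N. 2 ^ (n - 1) * (q N n - L)\<bar> \<le> (\<Sum>n=1..N. 2 ^ (n - 1) * \<bar>q N n - L\<bar>)"
        by (rule order_trans[OF sum_abs]) (simp add: abs_mult)
      \<comment> \<open>Early levels are charged the crude bound \<open>B\<close>, and every level
        is charged \<open>r / 2\<close>, so that the second part sums to a closed form over all of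
        \<open>{1..N}\<close>.\<close>
      also have "\<dots> \<le> (\<Sum>n=1..N. (if n \<in> {1..n0} then B * 2 ^ (n - 1) else 0) + r / 2 * 2 ^ (n - 1))"
      proof (rule sum_mono)
        fix n assume n: "n \<in> {1..N}"
        show "2 ^ (n - 1) * \<bar>q N n - L\<bar> \<le> (if n \<in> {1..n0} then B * 2 ^ (n - 1) else 0) + r / 2 * 2 ^ (n - 1)"
        proof (cases "n \<le> n0")
          case True
          have "2 ^ (n - 1) * \<bar>q N n - L\<bar> \<le> 2 ^ (n - 1) * B"
            using bnd by (intro mult_left_mono) auto
          then show ?thesis using True n r by (simp add: mult.commute add_increasing2)
        next
          case False
          have "2 ^ (n - 1) * \<bar>q N n - L\<bar> \<le> 2 ^ (n - 1) * (r / 2)"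
            using n0[of n N] False n by (intro mult_left_mono) auto
          then show ?thesis using False by (simp add: mult.commute)
        qed
      qed
      also have "\<dots> = (\<Sum>n\<in>{1..N} \<inter> {1..n0}. B * 2 ^ (n - 1)) + r / 2 * (2 ^ N - 1)"
        unfolding sum.distrib sum.inter_restrict[OF finite_atLeastAtMost]
          sum_distrib_left[symmetric, of "r / 2"] geo ..
      also have "(\<Sum>n\<in>{1..N} \<inter> {1..n0}. B * 2 ^ (n - 1)) \<le> (\<Sum>n=1..n0. B * 2 ^ (n - 1))"
        using B0 by (intro sum_mono2) auto
      also have "(\<Sum>n=1..n0. B * 2 ^ (n - 1)) \<le> B * 2 ^ n0"
        unfolding sum_distrib_left[symmetric] geo using B0 by (intro mult_left_mono) auto
      finally show ?thesis by simp
    qed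
    ultimately have "norm ((\<Sum>n=1..N. 2 ^ (n - 1) * q N n) / (2 ^ N - 1) - L)
        \<le> (B * 2 ^ n0 + r / 2 * (2 ^ N - 1)) / (2 ^ N - 1)"
      using pos by (simp add: divide_right_mono)
    also have "\<dots> = B * 2 ^ n0 / (2 ^ N - 1) + r / 2" 
      unfolding add_divide_distrib nonzero_mult_div_cancel_right[OF pos[THEN less_imp_neq, symmetric]] ..
    finally show ?case using elim(1) by linarith
  qed
  then show "\<exists>no. \<forall>N\<ge>no. norm ((\<Sum>n=1..N. 2 ^ (n - 1) * q N n) / (2 ^ N - 1) - L) < r"
    by (auto simp: eventually_sequentially)
qed

lemma card_signs: "card {xs :: real list. set xs \<subseteq> {-1, 1} \<and> length xs = m} = 2 ^ m"
  by (subst card_lists_length_eq) (auto simp: numeral_2_eq_2)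

lemma An_subset: "An H \<sigma> a N n \<subseteq> {xs. set xs \<subseteq> {-1, 1} \<and> length xs = n - 1}"
  by (auto simp: An_def)

lemma finite_An: "finite (An H \<sigma> a N n)"
  by (rule finite_subset[OF An_subset finite_lists_length_eq]) auto

text \<open>Levels are disjoint because lists at level \<open>n\<close> have length
  \<open>n - 1\<close> and \<open>n\<close> starts at 1.\<close>

lemma card_Aset: "card (Aset H \<sigma> a N) = (\<Sum>n=1..N. card (An H \<sigma> a N n))"
  unfolding Aset_def by (rule card_UN_disjoint) (auto simp: finite_An, auto simp: An_def)

theorem theorem3p3:
  fixes H \<sigma> :: real and a :: "real \<Rightarrow> real" and Nseq :: "nat \<Rightarrow> nat"
  assumes "1/2 < H" "H < 1" "\<sigma> > 0" "continuous_on {0..1} a"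
    and "\<forall>n. Nseq n \<ge> n"
  shows "(\<lambda>n. real (card (An H \<sigma> a (Nseq n) n)) / 2 ^ (n - 1))
           \<longlonglongrightarrow> measure Rad {\<xi> \<in> space Rad. \<bar>YH H \<sigma> \<xi>\<bar> > gH H \<sigma>}
      \<and> measure Rad {\<xi> \<in> space Rad. \<bar>YH H \<sigma> \<xi>\<bar> > gH H \<sigma>} > 0
      \<and> (\<lambda>N. real (card (Aset H \<sigma> a N)) / (2 ^ N - 1))
           \<longlonglongrightarrow> measure Rad {\<xi> \<in> space Rad. \<bar>YH H \<sigma> \<xi>\<bar> > gH H \<sigma>}"
proof (intro conjI)
  let ?L = "measure Rad {\<xi> \<in> space Rad. \<bar>YH H \<sigma> \<xi>\<bar> > gH H \<sigma>}"
  let ?q = "\<lambda>N n. real (card (An H \<sigma> a N n)) / 2 ^ (n - 1)"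
  have lim: "(\<lambda>n. ?q (f n) n) \<longlonglongrightarrow> ?L" if "\<And>n. n \<le> f n" for f
    using An_density_limit[OF assms(1-4) that] .
  show "(\<lambda>n. ?q (Nseq n) n) \<longlonglongrightarrow> ?L" using assms(5) by (intro lim) auto
  show "?L > 0" by (rule YH_exceeds_pos[OF assms(1-3)])
  have bnd: "\<bar>?q N n - ?L\<bar> \<le> 1" for N n
  proof -
    have "card (An H \<sigma> a N n) \<le> 2 ^ (n - 1)"
      using card_mono[OF finite_lists_length_eq An_subset, of H \<sigma> a N n] by (simp add: card_signs)
    then have "real (card (An H \<sigma> a N n)) \<le> 2 ^ (n - 1)" by (simp flip: of_nat_le_iff)
    then have "0 \<le> ?q N n" "?q N n \<le> 1" by auto
    moreover have "0 \<le> ?L" "?L \<le> 1" by auto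
    ultimately show ?thesis by linarith
  qed
  have "(\<lambda>N. (\<Sum>n=1..N. 2 ^ (n - 1) * ?q N n) / (2 ^ N - 1)) \<longlonglongrightarrow> ?L"
    \<comment> \<open>The weight of each level cancels the denominator of its density, so the
      average counts all levels relative to the size of the tree.\<close>
    by (rule weighted_average_limit[OF uniform_limit_from_sequences[of ?q, OF lim] bnd])
  then show "(\<lambda>N. real (card (Aset H \<sigma> a N)) / (2 ^ N - 1)) \<longlonglongrightarrow> ?L"
    by (simp add: card_Aset)
qed

end
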